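(* Let $M$ and $N$ be loopfree matroids on the same finite ground set such that $B(N)$ is a subcycle of $B(M)$ of codimension $k$. Then there are rational functions $\varphi_1,\ldots,\varphi_k$ on $B(M)$ such that $\varphi_1\cdots\varphi_k\cdot B(M)=B(N)$.
   Context: Tropical cycles. Let $V=\Lambda\otimes\mathbb R$ for a lattice $\Lambda$. A tropical $k$-cycle in $V$ is a pure $k$-dimensional rational polyhedral complex with integer weights $\omega(\sigma)$ on its facets, satisfying for each codimension one cell $\tau$ the balancing condition $\sum_{\sigma>\tau}\omega(\sigma)v_{\sigma/\tau}\in V_\tau$ ($v_{\sigma/\tau}$ primitive normal vectors, $V_\tau$ the linear space spanned by differences of points of $\tau$), taken modulo refinement and discarding weight $0$ facets. $|C|$ is its support; a subcycle of $X$ is a cycle $C$ with $|C|\subseteq|X|$. A rational function on $C$ is a continuous function $\varphi:|C|\to\mathbb R$ that is integer affine linear on the cells of some polyhedral structure of $C$. Its divisor $\varphi\cdot C$ is the cycle of dimension $\dim C-1$ whose weight at a codimension one cell $\tau$ is $\sum_{\sigma>\tau}\varphi_\sigma(\omega(\sigma)v_{\sigma/\tau})-\varphi_\tau\big(\sum_{\sigma>\tau}\omega(\sigma)v_{\sigma/\tau}\big)$, where $\varphi_\sigma,\varphi_\tau$ are the linear parts of $\varphi$. Products such as $\varphi_1\cdots\varphi_k\cdot C$ are iterated divisors (restricting the functions to the supports obtained). Matroid varieties. Let $M$ be a loopfree matroid (each element of the ground set has rank $1$) on $E=\{1,\ldots,n\}$. For $F\subseteq E$ put $V_F=-\sum_{i\in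 F}e_i\in\mathbb R^n$. The fine subdivision of $B(M)$ is the fan of all cones $\{\sum_{i=1}^p\lambda_iV_{F_i}:\lambda_1,\ldots,\lambda_{p-1}\ge 0,\ \lambda_p\in\mathbb R\}$ for chains of flats $\emptyset\subsetneq F_1\subsetneq\cdots\subsetneq F_p=E$ of $M$. With weight $1$ on all facets it defines a tropical cycle $B(M)$ in $\mathbb R^n$ of dimension $\operatorname{rank}(M)$, called the matroid variety of $M$. *)

theory Defs
  imports "HOL-Analysis.Analysis"
begin

section \<open>Matroids\<close>

text \<open>A matroid is given by its ground set and its family of independent sets.\<close>

definition matroid :: "'a set \<Rightarrow> 'a set set \<Rightarrow> bool" where
  "matroid E M \<longleftrightarrow> finite E \<and> M \<subseteq> Pow E \<and> {} \<in> M \<and>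
     (\<forall>A\<in>M. \<forall>B\<subseteq>A. B \<in> M) \<and>
     (\<forall>A\<in>M. \<forall>B\<in>M. card A < card B \<longrightarrow> (\<exists>x\<in>B - A. insert x A \<in> M))"

definition matroid_rank :: "'a set set \<Rightarrow> 'a set \<Rightarrow> nat" where
  "matroid_rank M A = Max (card ` {B \<in> M. B \<subseteq> A})"

definition loopfree :: "'a set \<Rightarrow> 'a set set \<Rightarrow> bool" where
  "loopfree E M \<longleftrightarrow> (\<forall>e\<in>E. matroid_rank M {e} = 1)"

definition flats :: "'a set \<Rightarrow> 'a set set \<Rightarrow> 'a set set" where
  "flats E M = {F. F \<subseteq> E \<and> (\<forall>x\<in>E - F. matroid_rank M F < matroid_rank M (insert x F))}"

section \<open>Weighted rational polyhedral complexes\<close>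

text \<open>The ambient lattice is \<open>\<int>\<^sup>n\<close> inside \<open>\<real>\<^sup>n\<close>; its dual is identified with
  \<open>\<int>\<^sup>n\<close> by the standard inner product.\<close>

definition integer_vec :: "real^'n \<Rightarrow> bool" where
  "integer_vec v \<longleftrightarrow> (\<forall>i. v $ i \<in> \<int>)"

text \<open>Only the slopes of the defining inequalities are integral, the constants are real.\<close>

definition rational_polyhedron :: "(real^'n) set \<Rightarrow> bool" where
  "rational_polyhedron P \<longleftrightarrow>
     (\<exists>H. finite H \<and> (\<forall>(a, b)\<in>H. integer_vec a) \<and> P = {x. \<forall>(a, b)\<in>H. a \<bullet> x \<le> b})"

text \<open>The dimension is a field of the record, so that the zero cycles of the various
  dimensions are told apart. Only the weights of the facets are meaningful.\<close>

record 'v weighted_complex =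
  wdim :: nat
  cells :: "'v set set"
  weight :: "'v set \<Rightarrow> int"

definition facets :: "(real^'n) weighted_complex \<Rightarrow> (real^'n) set set" where
  "facets X = {\<sigma> \<in> cells X. aff_dim \<sigma> = int (wdim X)}"

definition ridges :: "(real^'n) weighted_complex \<Rightarrow> (real^'n) set set" where
  "ridges X = {\<tau> \<in> cells X. aff_dim \<tau> = int (wdim X) - 1}"

definition facets_above :: "(real^'n) weighted_complex \<Rightarrow> (real^'n) set \<Rightarrow> (real^'n) set set" where
  "facets_above X \<tau> = {\<sigma> \<in> facets X. \<tau> \<subset> \<sigma>}"

definition support :: "(real^'n) weighted_complex \<Rightarrow> (real^'n) set" where
  "support X = \<Union>{\<sigma> \<in> facets X. weight X \<sigma> \<noteq> 0}"

text \<open>Cells are nonempty, so the empty set (which satisfies \<^const>\<open>face_of\<close>) is left out.\<close>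

definition polyhedral_complex :: "(real^'n) set set \<Rightarrow> bool" where
  "polyhedral_complex K \<longleftrightarrow> finite K \<and>
     (\<forall>\<sigma>\<in>K. \<sigma> \<noteq> {} \<and> rational_polyhedron \<sigma>) \<and>
     (\<forall>\<sigma>\<in>K. \<forall>\<tau>. \<tau> face_of \<sigma> \<and> \<tau> \<noteq> {} \<longrightarrow> \<tau> \<in> K) \<and>
     (\<forall>\<sigma>\<in>K. \<forall>\<tau>\<in>K. (\<sigma> \<inter> \<tau>) face_of \<sigma> \<and> (\<sigma> \<inter> \<tau>) face_of \<tau>)"

definition pure_complex :: "(real^'n) weighted_complex \<Rightarrow> bool" where
  "pure_complex X \<longleftrightarrow> (\<forall>\<tau>\<in>cells X. \<exists>\<sigma>\<in>facets X. \<tau> \<subseteq> \<sigma>)"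

text \<open>The linear space \<open>V\<^sub>\<sigma>\<close>.\<close>

definition direction :: "(real^'n) set \<Rightarrow> (real^'n) set" where
  "direction \<sigma> = span {x - y | x y. x \<in> \<sigma> \<and> y \<in> \<sigma>}"

text \<open>A primitive normal vector \<open>v\<close> generates \<open>(\<Lambda> \<inter> V\<^sub>\<sigma>) / (\<Lambda> \<inter> V\<^sub>\<tau>)\<close> and points from \<open>\<tau>\<close> into
  \<open>\<sigma>\<close>. It is unique only modulo \<open>\<Lambda> \<inter> V\<^sub>\<tau>\<close>; neither balancing nor the weights of divisors
  depend on the choice.\<close>

definition primitive_normal :: "(real^'n) set \<Rightarrow> (real^'n) set \<Rightarrow> real^'n \<Rightarrow> bool" where
  "primitive_normal \<sigma> \<tau> v \<longleftrightarrow> integer_vec v \<and> v \<in> direction \<sigma> \<and>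
     (\<forall>u. integer_vec u \<and> u \<in> direction \<sigma> \<longrightarrow> (\<exists>m::int. u - of_int m *\<^sub>R v \<in> direction \<tau>)) \<and>
     (\<exists>x\<in>\<tau>. \<exists>\<epsilon>>0. x + \<epsilon> *\<^sub>R v \<in> \<sigma>)"

definition normal_vector :: "(real^'n) set \<Rightarrow> (real^'n) set \<Rightarrow> real^'n" where
  "normal_vector \<sigma> \<tau> = (SOME v. primitive_normal \<sigma> \<tau> v)"

definition weighted_normal_sum :: "(real^'n) weighted_complex \<Rightarrow> (real^'n) set \<Rightarrow> real^'n" where
  "weighted_normal_sum X \<tau> =
     (\<Sum>\<sigma>\<in>facets_above X \<tau>. of_int (weight X \<sigma>) *\<^sub>R normal_vector \<sigma> \<tau>)"

definition balanced :: "(real^'n) weighted_complex \<Rightarrow> bool" where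
  "balanced X \<longleftrightarrow> (\<forall>\<tau>\<in>ridges X. weighted_normal_sum X \<tau> \<in> direction \<tau>)"

section \<open>Tropical cycles\<close>

text \<open>A tropical cycle is handled through its representatives, the balanced complexes below;
  equality of cycles is \<open>cycle_eq\<close>.\<close>

definition tropical_cycle :: "(real^'n) weighted_complex \<Rightarrow> bool" where
  "tropical_cycle X \<longleftrightarrow> polyhedral_complex (cells X) \<and> pure_complex X \<and> balanced X"

text \<open>Facets of weight \<open>0\<close> are ignored on both sides. Since \<open>\<sigma>\<close> has full dimension in \<open>\<sigma>'\<close>,
  there is at most one such \<open>\<sigma>'\<close>.\<close>

definition refines :: "(real^'n) weighted_complex \<Rightarrow> (real^'n) weighted_complex \<Rightarrow> bool" where
  "refines Y X \<longleftrightarrow> wdim Y = wdim X \<and> support Y = support X \<and>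
     (\<forall>\<sigma>\<in>facets Y. weight Y \<sigma> \<noteq> 0 \<longrightarrow>
        (\<exists>\<sigma>'\<in>facets X. \<sigma> \<subseteq> \<sigma>' \<and> weight Y \<sigma> = weight X \<sigma>'))"

definition cycle_eq :: "(real^'n) weighted_complex \<Rightarrow> (real^'n) weighted_complex \<Rightarrow> bool" where
  "cycle_eq X Y \<longleftrightarrow> tropical_cycle X \<and> tropical_cycle Y \<and>
     (\<exists>Z. tropical_cycle Z \<and> refines Z X \<and> refines Z Y)"

definition subcycle :: "(real^'n) weighted_complex \<Rightarrow> (real^'n) weighted_complex \<Rightarrow> bool" where
  "subcycle C X \<longleftrightarrow> tropical_cycle C \<and> support C \<subseteq> support X"

section \<open>Rational functions and their divisors\<close>

definition integer_affine_on :: "(real^'n) set \<Rightarrow> (real^'n \<Rightarrow> real) \<Rightarrow> real^'n \<Rightarrow> bool" where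
  "integer_affine_on \<sigma> \<phi> a \<longleftrightarrow> integer_vec a \<and> (\<exists>c. \<forall>x\<in>\<sigma>. \<phi> x = a \<bullet> x + c)"

text \<open>A polyhedral structure of \<open>C\<close> has no facets of weight \<open>0\<close>, so that its cells cover
  exactly \<open>support C\<close>, where \<open>\<phi>\<close> is defined.\<close>

definition structure_for ::
  "(real^'n \<Rightarrow> real) \<Rightarrow> (real^'n) weighted_complex \<Rightarrow> (real^'n) weighted_complex \<Rightarrow> bool" where
  "structure_for \<phi> C X \<longleftrightarrow> cycle_eq X C \<and> (\<forall>\<sigma>\<in>facets X. weight X \<sigma> \<noteq> 0) \<and>
     (\<forall>\<sigma>\<in>cells X. \<exists>a. integer_affine_on \<sigma> \<phi> a)"

text \<open>A function on \<open>support C\<close> is represented by a total function whose values elsewhere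
  are irrelevant; hence restricting it to smaller supports is implicit.\<close>

definition rational_function :: "(real^'n) weighted_complex \<Rightarrow> (real^'n \<Rightarrow> real) \<Rightarrow> bool" where
  "rational_function C \<phi> \<longleftrightarrow> continuous_on (support C) \<phi> \<and> (\<exists>X. structure_for \<phi> C X)"

text \<open>The linear part \<open>\<phi>\<^sub>\<sigma>\<close>; the covector chosen is unique only up to covectors vanishing on
  \<open>V\<^sub>\<sigma>\<close>, and \<open>\<phi>\<^sub>\<sigma>\<close> is evaluated only on \<open>V\<^sub>\<sigma>\<close>.\<close>

definition linear_part :: "(real^'n \<Rightarrow> real) \<Rightarrow> (real^'n) set \<Rightarrow> real^'n \<Rightarrow> real" where
  "linear_part \<phi> \<sigma> v = (SOME a. integer_affine_on \<sigma> \<phi> a) \<bullet> v"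

text \<open>The number under the floor is an integer: linear parts and normal vectors are integral.
  A cycle of dimension \<open>0\<close> gets the empty complex.\<close>

definition complex_divisor ::
  "(real^'n \<Rightarrow> real) \<Rightarrow> (real^'n) weighted_complex \<Rightarrow> (real^'n) weighted_complex" where
  "complex_divisor \<phi> X = \<lparr>
     wdim = wdim X - 1,
     cells = {\<tau> \<in> cells X. aff_dim \<tau> < int (wdim X)},
     weight = (\<lambda>\<tau>. \<lfloor>(\<Sum>\<sigma>\<in>facets_above X \<tau>.
                       linear_part \<phi> \<sigma> (of_int (weight X \<sigma>) *\<^sub>R normal_vector \<sigma> \<tau>))
                   - linear_part \<phi> \<tau> (weighted_normal_sum X \<tau>)\<rfloor>) \<rparr>"

text \<open>\<open>is_divisor \<phi> C D\<close> means \<open>\<phi> \<cdot> C = D\<close>. The divisor is computed on a polyhedral structure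
  of \<open>C\<close> adapted to \<open>\<phi>\<close>; as a cycle it does not depend on that structure.\<close>

definition is_divisor ::
  "(real^'n \<Rightarrow> real) \<Rightarrow> (real^'n) weighted_complex \<Rightarrow> (real^'n) weighted_complex \<Rightarrow> bool" where
  "is_divisor \<phi> C D \<longleftrightarrow> rational_function C \<phi> \<and>
     (\<exists>X. structure_for \<phi> C X \<and> cycle_eq (complex_divisor \<phi> X) D)"

text \<open>\<open>is_product [\<phi>\<^sub>1, \<dots>, \<phi>\<^sub>k] C D\<close> means \<open>\<phi>\<^sub>1 \<cdots> \<phi>\<^sub>k \<cdot> C = D\<close>, bracketed as
  \<open>\<phi>\<^sub>1 \<cdot> (\<dots> \<cdot> (\<phi>\<^sub>k \<cdot> C))\<close>.\<close>

fun is_product ::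
  "(real^'n \<Rightarrow> real) list \<Rightarrow> (real^'n) weighted_complex \<Rightarrow> (real^'n) weighted_complex \<Rightarrow> bool" where
  "is_product [] C D \<longleftrightarrow> cycle_eq C D"
| "is_product (\<phi> # \<phi>s) C D \<longleftrightarrow> (\<exists>C'. is_product \<phi>s C C' \<and> is_divisor \<phi> C' D)"

section \<open>Matroid varieties\<close>

text \<open>The ground set is the index type: \<open>E = UNIV\<close>.\<close>

definition flat_vector :: "'n set \<Rightarrow> real^'n" where
  "flat_vector F = - (\<Sum>i\<in>F. axis i 1)"

text \<open>The chain \<open>F\<^sub>1 \<subset> \<dots> \<subset> F\<^sub>p = E\<close> is encoded by the set of its members.\<close>

definition flat_chains :: "'n set set \<Rightarrow> 'n set set set" where
  "flat_chains M = {\<F>. \<F> \<subseteq> flats UNIV M \<and> chain\<^sub>\<subseteq> \<F> \<and> {} \<notin> \<F> \<and> UNIV \<in> \<F>}"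

definition chain_cone :: "'n set set \<Rightarrow> (real^'n) set" where
  "chain_cone \<F> = {\<Sum>F\<in>\<F>. c F *\<^sub>R flat_vector F | c. \<forall>F\<in>\<F> - {UNIV}. 0 \<le> c F}"

definition matroid_variety :: "'n set set \<Rightarrow> (real^'n) weighted_complex" where
  "matroid_variety M = \<lparr>
     wdim = matroid_rank M UNIV,
     cells = chain_cone ` flat_chains M,
     weight = (\<lambda>_. 1) \<rparr>"

end

(* Since V_F = - 1_F, the cone of a flag determines its flats as sublevel sets, so the inclusion of
   supports says that every flat of N is a flat of M, i.e. N is a quotient of M: the difference
   d(A) = r_M(A) - r_N(A) is monotone in A. Higgs' rank functions r_i(A) = min (r_N(A) + i) (r_M(A))
   interpolate between r_0 = r_N and r_k = r_M, with r_i - r_(i-1) the indicator of the up-set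
   U_i = {A. d(A) >= i}.

   Put phi_i(x) = min {max {x_j | j : A} | A : U_i}. It is continuous, agrees with a coordinate
   function on the cone of every flag, and takes V_F to -1 if F lies in U_i and to 0 otherwise. A
   ridge of B(M_i) is a flag of flats with one rank missing, between A and B say; the flats strictly
   between A and B partition B - A, and the weight of phi_i . B(M_i) there is
   [B : U_i] + (m - 1) [A : U_i] - n, where m flats lie strictly between and n of them lie in U_i.
   By submodularity of r_(i-1) this is 1 if the flag consists of flats of r_(i-1), and 0 otherwise. Hence
   phi_i . B(M_i) = B(M_(i-1)). *)
theory Submission
  imports Defs
begin

section \<open>Flags and their cones\<close>

text \<open>The theorem is iterated from a single step, in which a rank function drops by one
  exactly on an up-set. Polyhedral questions are settled once, for families of flags closed under
  subflags; what remains is counting at one ridge. The weight formula there has a linear origin: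
  since the m flats G between A and B partition B - A, the sum of the V_G is V_B + (m - 1) V_A. This
  relation is the balancing condition, and phi_i evaluated on it gives the weight. An empty A fits
  in because then V_A = 0.

  Three features of the formal notions shape the rest. Normal vectors and linear parts are arbitrary
  choices, so the normal vector at G is compared with V_G modulo the span of the ridge, and the
  discrepancy cancels in the weight. The divisor keeps its cells of weight 0, so it may be a larger
  complex than B(M_(i-1)), and its purity and balancing are separate claims. Finally each phi_i has
  to be rational on all of B(M), not only on the cycle that it cuts; hence a formula on the whole
  space instead of a definition cone by cone.\<close>

definition flag :: "'a set set \<Rightarrow> bool" where
  "flag \<F> \<longleftrightarrow> chain\<^sub>\<subseteq> \<F> \<and> {} \<notin> \<F> \<and> UNIV \<in> \<F>"

lemma flag_subset: "flag \<F> \<Longrightarrow> \<G> \<subseteq> \<F> \<Longrightarrow> UNIV \<in> \<G> \<Longrightarrow> flag \<G>"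
  by (auto simp: flag_def chain_subset_def)

lemma flag_linear: "flag \<F> \<Longrightarrow> F \<in> \<F> \<Longrightarrow> G \<in> \<F> \<Longrightarrow> F \<subseteq> G \<or> G \<subseteq> F"
  unfolding flag_def chain_subset_def by blast

lemma finite_chain_Union_mem:
  "finite \<C> \<Longrightarrow> \<C> \<noteq> {} \<Longrightarrow> chain\<^sub>\<subseteq> \<C> \<Longrightarrow> \<Union>\<C> \<in> \<C>"
proof (induction \<C> rule: finite_ne_induct)
  case (insert A \<C>)
  then have "\<Union>\<C> \<in> \<C>" by (auto simp: chain_subset_def)
  moreover from this have "A \<subseteq> \<Union>\<C> \<or> \<Union>\<C> \<subseteq> A" using insert.prems by (auto simp: chain_subset_def)
  then have "A \<union> \<Union>\<C> = A \<or> A \<union> \<Union>\<C> = \<Union>\<C>" by blast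
  ultimately show ?case by auto
qed auto

lemma finite_chain_Inter_mem:
  "finite \<C> \<Longrightarrow> \<C> \<noteq> {} \<Longrightarrow> chain\<^sub>\<subseteq> \<C> \<Longrightarrow> \<Inter>\<C> \<in> \<C>"
proof (induction \<C> rule: finite_ne_induct)
  case (insert A \<C>)
  then have "\<Inter>\<C> \<in> \<C>" by (auto simp: chain_subset_def)
  moreover from this have "A \<subseteq> \<Inter>\<C> \<or> \<Inter>\<C> \<subseteq> A" using insert.prems by (auto simp: chain_subset_def)
  then have "A \<inter> \<Inter>\<C> = A \<or> A \<inter> \<Inter>\<C> = \<Inter>\<C>" by blast
  ultimately show ?case by auto
qed auto

text \<open>The members not containing \<open>F\<close> form a chain, so their union is the largest
  of them and still misses a point of \<open>F\<close>; that point is the pivot. If there are no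
  such members, any point of the nonempty set \<open>F\<close> will do.\<close>

lemma flag_pivot:
  fixes \<F> :: "'a::finite set set"
  assumes "flag \<F>" "F \<in> \<F>"
  obtains p where "\<And>G. G \<in> \<F> \<Longrightarrow> p \<in> G \<longleftrightarrow> F \<subseteq> G"
proof -
  let ?\<D> = "{G \<in> \<F>. \<not> F \<subseteq> G}"
  have "\<exists>p. p \<in> F \<and> p \<notin> \<Union>?\<D>"
  proof (cases "?\<D> = {}")
    case True
    have "F \<noteq> {}" using assms by (auto simp: flag_def)
    with True show ?thesis by (metis Union_empty empty_iff ex_in_conv)
  next
    case False
    then have "\<Union>?\<D> \<in> ?\<D>"
      using assms by (intro finite_chain_Union_mem) (auto simp: flag_def chain_subset_def)
    then show ?thesis by blast
  qed
  then obtain p where "p \<in> F" "p \<notin> \<Union>?\<D>" by blast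
  then have "p \<in> G \<longleftrightarrow> F \<subseteq> G" if "G \<in> \<F>" for G using that by blast
  then show ?thesis by (rule that)
qed

section \<open>Coordinates dual to the flat vectors of a flag\<close>

lemma flat_vector_nth: "flat_vector F $ i = - of_bool (i \<in> F)"
  by (simp add: flat_vector_def axis_def sum.delta)

lemma integer_vec_axis: "integer_vec (axis i 1)"
  by (simp add: integer_vec_def axis_def)

lemma integer_vec_flat_vector: "integer_vec (flat_vector F)"
  by (simp add: integer_vec_def flat_vector_nth)

lemma integer_vec_diff: "integer_vec u \<Longrightarrow> integer_vec v \<Longrightarrow> integer_vec (u - v)"
  by (simp add: integer_vec_def)

lemma integer_vec_inner: "integer_vec u \<Longrightarrow> integer_vec v \<Longrightarrow> u \<bullet> v \<in> \<int>"
  unfolding integer_vec_def inner_vec_def by (rule Ints_sum) simp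

text \<open>The negated coordinate at the pivot of \<open>F\<close> adds up the coefficients of all
  members containing \<open>F\<close>; subtracting the same sum for the next larger member isolates
  the coefficient of \<open>F\<close>. The functional is integral, which later decides primitivity
  of normal vectors.\<close>

lemma flag_dual_exists:
  fixes \<F> :: "'n::finite set set"
  assumes "flag \<F>" "F \<in> \<F>"
  shows "\<exists>u. integer_vec u \<and> (\<forall>G\<in>\<F>. u \<bullet> flat_vector G = of_bool (G = F))"
proof -
  obtain p where p: "\<And>G. G \<in> \<F> \<Longrightarrow> p \<in> G \<longleftrightarrow> F \<subseteq> G"
    by (rule flag_pivot[OF assms]) blast
  let ?\<S> = "{G \<in> \<F>. F \<subset> G}"
  show ?thesis
  proof (cases "?\<S> = {}")
    case True
    then have "G = F" if "G \<in> \<F>" "F \<subseteq> G" for G using that by blast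
    then have "p \<in> G \<longleftrightarrow> G = F" if "G \<in> \<F>" for G using p that by blast
    moreover have "integer_vec (- axis p 1 :: real^'n)" by (simp add: integer_vec_def axis_def)
    ultimately show ?thesis
      by (intro exI[of _ "- axis p 1"]) (auto simp: inner_axis' flat_vector_nth)
  next
    case False
    then have S: "\<Inter>?\<S> \<in> ?\<S>"
      using assms by (intro finite_chain_Inter_mem) (auto simp: flag_def chain_subset_def)
    then have "\<Inter>?\<S> \<in> \<F>" by simp
    then obtain q where q: "\<And>G. G \<in> \<F> \<Longrightarrow> q \<in> G \<longleftrightarrow> \<Inter>?\<S> \<subseteq> G"
      by (rule flag_pivot[OF assms(1)]) blast
    have "q \<in> G \<longleftrightarrow> F \<subset> G" if "G \<in> \<F>" for G
      using q[OF that] S that by (auto; blast)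
    then show ?thesis using p
      by (intro exI[of _ "axis q 1 - axis p 1"])
        (auto simp: inner_axis' inner_diff_left flat_vector_nth integer_vec_axis intro!: integer_vec_diff)
  qed
qed

text \<open>Determined only modulo functionals vanishing on the span of the flag; on that span it is
  the coordinate of \<open>F\<close> in the basis of flat vectors.\<close>

definition flag_dual :: "'n::finite set set \<Rightarrow> 'n set \<Rightarrow> real^'n" where
  "flag_dual \<F> F = (SOME u. integer_vec u \<and> (\<forall>G\<in>\<F>. u \<bullet> flat_vector G = of_bool (G = F)))"

lemma
  assumes "flag \<F>" "F \<in> \<F>"
  shows integer_vec_flag_dual: "integer_vec (flag_dual \<F> F)"
    and flag_dual_flat_vector: "G \<in> \<F> \<Longrightarrow> flag_dual \<F> F \<bullet> flat_vector G = of_bool (G = F)"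
  using someI_ex[OF flag_dual_exists[OF assms], folded flag_dual_def] by simp_all

lemma flag_dual_sum:
  assumes "flag \<F>" "F \<in> \<F>"
  shows "flag_dual \<F> F \<bullet> (\<Sum>G\<in>\<F>. c G *\<^sub>R flat_vector G) = c F"
proof -
  have "flag_dual \<F> F \<bullet> (\<Sum>G\<in>\<F>. c G *\<^sub>R flat_vector G) = (\<Sum>G\<in>\<F>. c G * of_bool (G = F))"
    using assms by (simp add: inner_sum_right flag_dual_flat_vector)
  also have "\<dots> = (\<Sum>G\<in>\<F>. if G = F then c G else 0)" by (intro sum.cong) auto
  finally show ?thesis using assms by (simp add: sum.delta)
qed

lemma span_flat_vectors_expansion:
  assumes "flag \<F>" "x \<in> span (flat_vector ` \<F>)"
  shows "x = (\<Sum>F\<in>\<F>. (flag_dual \<F> F \<bullet> x) *\<^sub>R flat_vector F)"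
proof (rule linear_eq_on_span[OF _ _ _ assms(2)])
  show "linear (\<lambda>x::real^'a. x)" by (simp add: linear_iff)
  show "linear (\<lambda>x. \<Sum>F\<in>\<F>. (flag_dual \<F> F \<bullet> x) *\<^sub>R flat_vector F)"
    by (simp add: linear_iff inner_add_right scaleR_add_left sum.distrib scaleR_sum_right)
  fix x :: "real^'a" assume "x \<in> flat_vector ` \<F>"
  then obtain G where G: "G \<in> \<F>" "x = flat_vector G" by blast
  have "(\<Sum>F\<in>\<F>. (flag_dual \<F> F \<bullet> x) *\<^sub>R flat_vector F)
      = (\<Sum>F\<in>\<F>. if F = G then flat_vector F else 0)"
    using G assms(1) by (intro sum.cong) (auto simp: flag_dual_flat_vector)
  then show "x = (\<Sum>F\<in>\<F>. (flag_dual \<F> F \<bullet> x) *\<^sub>R flat_vector F)" using G by simp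
qed

text \<open>The dual functionals recover the coefficients, so the cone is cut out of its span by
  sign conditions. \<open>UNIV\<close> is exempt: its vector spans the lineality space.\<close>

lemma mem_chain_cone_iff:
  assumes "flag \<F>"
  shows "x \<in> chain_cone \<F> \<longleftrightarrow>
    x \<in> span (flat_vector ` \<F>) \<and> (\<forall>F\<in>\<F> - {UNIV}. 0 \<le> flag_dual \<F> F \<bullet> x)" (is "?L \<longleftrightarrow> ?R")
proof
  assume ?L
  then obtain c where c: "x = (\<Sum>F\<in>\<F>. c F *\<^sub>R flat_vector F)" "\<forall>F\<in>\<F> - {UNIV}. 0 \<le> c F"
    by (auto simp: chain_cone_def)
  have "x \<in> span (flat_vector ` \<F>)" unfolding c(1) by (intro span_sum span_scale span_base imageI)
  then show ?R using assms c by (auto simp: flag_dual_sum)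
next
  assume ?R
  then show ?L using span_flat_vectors_expansion[OF assms, of x] unfolding chain_cone_def
    by (intro CollectI exI[of _ "\<lambda>F. flag_dual \<F> F \<bullet> x"]) auto
qed

lemma zero_mem_chain_cone: "0 \<in> chain_cone \<F>"
  unfolding chain_cone_def by (rule CollectI, rule exI[of _ "\<lambda>_. 0"]) simp

lemma flat_vector_mem_chain_cone:
  assumes "flag \<F>" "F \<in> \<F>"
  shows "flat_vector F \<in> chain_cone \<F>"
  using assms by (auto simp: mem_chain_cone_iff flag_dual_flat_vector intro: span_base)

lemma convex_chain_cone:
  assumes "flag \<F>"
  shows "convex (chain_cone \<F>)"
  using assms by (auto simp: convex_def mem_chain_cone_iff inner_add_right intro!: span_add span_scale)

lemma inj_on_flat_vector: "inj_on flat_vector \<F>"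
proof (rule inj_onI)
  fix F G :: "'a set" assume "flat_vector F = flat_vector G"
  then have "of_bool (i \<in> F) = (of_bool (i \<in> G) :: real)" for i
    by (metis flat_vector_nth neg_equal_iff_equal)
  then show "F = G" by (metis of_bool_eq_iff subsetI subset_antisym)
qed

lemma direction_chain_cone:
  assumes "flag \<F>"
  shows "direction (chain_cone \<F>) = span (flat_vector ` \<F>)"
proof
  show "direction (chain_cone \<F>) \<subseteq> span (flat_vector ` \<F>)"
    unfolding direction_def
    using assms by (intro span_minimal) (auto simp: mem_chain_cone_iff intro: span_diff)
  have "flat_vector F \<in> {x - y |x y. x \<in> chain_cone \<F> \<and> y \<in> chain_cone \<F>}" if "F \<in> \<F>" for F
    using flat_vector_mem_chain_cone[OF assms that] zero_mem_chain_cone[of \<F>]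
    by (metis (mono_tags, lifting) CollectI diff_zero)
  then show "span (flat_vector ` \<F>) \<subseteq> direction (chain_cone \<F>)"
    unfolding direction_def by (intro span_mono) blast
qed

lemma aff_dim_chain_cone:
  assumes "flag \<F>"
  shows "aff_dim (chain_cone \<F>) = int (card \<F>)"
proof -
  have "independent (flat_vector ` \<F>)"
  proof (rule independent_if_scalars_zero)
    fix f :: "real^'a \<Rightarrow> real" and v
    assume 0: "(\<Sum>x\<in>flat_vector ` \<F>. f x *\<^sub>R x) = 0" and "v \<in> flat_vector ` \<F>"
    then obtain F where F: "F \<in> \<F>" "v = flat_vector F" by blast
    have "(\<Sum>F\<in>\<F>. f (flat_vector F) *\<^sub>R flat_vector F) = 0"
      using 0 by (simp add: sum.reindex[OF inj_on_flat_vector])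
    then show "f v = 0" using flag_dual_sum[OF assms F(1), of "\<lambda>F. f (flat_vector F)"] F(2) by simp
  qed simp
  then have "dim (chain_cone \<F>) = card \<F>"
    using assms flat_vector_mem_chain_cone[OF assms]
    by (intro dim_unique[of "flat_vector ` \<F>"])
      (auto simp: mem_chain_cone_iff card_image[OF inj_on_flat_vector])
  then show ?thesis
    using zero_mem_chain_cone[of \<F>] by (simp add: aff_dim_zero hull_inc)
qed

text \<open>A flag preorders the coordinates, and its cone consists of the vectors monotone for that
  preorder. For the converse the smallest member \<open>A\<close> is peeled off: a monotone vector
  is constant on \<open>A\<close>, and its jump from \<open>A\<close> to the next member is the
  coefficient of \<open>A\<close>.\<close>

lemma chain_cone_halfspaces:
  fixes \<F> :: "'n::finite set set"
  assumes "flag \<F>"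
  shows "chain_cone \<F> = {x. \<forall>i j. (\<forall>F\<in>\<F>. i \<in> F \<longrightarrow> j \<in> F) \<longrightarrow> x $ j \<le> x $ i}"
    (is "_ = ?P \<F>")
proof
  show "chain_cone \<F> \<subseteq> ?P \<F>"
  proof
    fix x assume "x \<in> chain_cone \<F>"
    then obtain c where c: "x = (\<Sum>F\<in>\<F>. c F *\<^sub>R flat_vector F)" "\<forall>F\<in>\<F> - {UNIV}. 0 \<le> c F"
      by (auto simp: chain_cone_def)
    have "x $ j \<le> x $ i" if "\<forall>F\<in>\<F>. i \<in> F \<longrightarrow> j \<in> F" for i j
      unfolding c(1) sum_component
    proof (rule sum_mono)
      fix F assume "F \<in> \<F>"
      with that c(2) show "(c F *\<^sub>R flat_vector F) $ j \<le> (c F *\<^sub>R flat_vector F) $ i"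
        by (cases "F = UNIV") (auto simp: flat_vector_nth)
    qed
    then show "x \<in> ?P \<F>" by blast
  qed
next
  have "x \<in> chain_cone \<F>" if "flag \<F>" "x \<in> ?P \<F>" for x and \<F> :: "'n set set"
    using that
  proof (induction "card \<F>" arbitrary: \<F> x rule: less_induct)
    case less
    have mono: "x $ j \<le> x $ i" if "\<forall>F\<in>\<F>. i \<in> F \<longrightarrow> j \<in> F" for i j
      using less.prems(2) that by blast
    define A where "A = \<Inter>\<F>"
    have A: "A \<in> \<F>" using less.prems(1) unfolding A_def
      by (intro finite_chain_Inter_mem) (auto simp: flag_def)
    then obtain a where a: "a \<in> A" using less.prems(1) unfolding flag_def by (metis ex_in_conv)
    show ?case
    proof (cases "A = UNIV")
      case True
      then have "F = UNIV" if "F \<in> \<F>" for F using that unfolding A_def by blast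
      then have "\<F> = {UNIV}" using A by blast
      moreover have "x $ i = x $ a" for i
        using mono[of i a] mono[of a i] True A_def by force
      then have "x = (- x $ a) *\<^sub>R flat_vector UNIV" by (simp add: vec_eq_iff flat_vector_nth)
      ultimately show ?thesis unfolding chain_cone_def
        by (intro CollectI exI[of _ "\<lambda>_. - x $ a"]) auto
    next
      case False
      define \<G> where "\<G> = \<F> - {A}"
      have flag: "flag \<G>" using less.prems(1) False unfolding \<G>_def
        by (auto simp: flag_def chain_subset_def)
      have card: "card \<G> < card \<F>" unfolding \<G>_def using A by (intro psubset_card_mono) auto
      define B where "B = \<Inter>\<G>"
      have B: "B \<in> \<G>" using flag unfolding B_def
        by (intro finite_chain_Inter_mem) (auto simp: flag_def)
      then have AB: "A \<subset> B" unfolding A_def \<G>_def by blast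
      then obtain b where b: "b \<in> B" "b \<notin> A" by blast
      have ba: "x $ a \<le> x $ b" using a by (intro mono) (auto simp: A_def)
      \<comment> \<open>Lifts the value on \<open>A\<close> to the value on \<open>B - A\<close>, so
        that \<open>A\<close> no longer separates coordinates and the smaller flag \<G>
        suffices.\<close>
      define x' where "x' = x - (x $ b - x $ a) *\<^sub>R flat_vector A"
      have x'A: "x' $ i = x $ b" if "i \<in> A" for i
        using mono[of i a] mono[of a i] a that
        by (force simp: x'_def flat_vector_nth A_def)
      have x'N: "x' $ i = x $ i" if "i \<notin> A" for i
        using that by (simp add: x'_def flat_vector_nth)
      have "x' $ j \<le> x' $ i" if ij: "\<forall>F\<in>\<G>. i \<in> F \<longrightarrow> j \<in> F" for i j
      proof (cases "i \<in> A")
        case True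
        then have j: "j \<in> F" if "F \<in> \<G>" for F using ij that AB unfolding A_def \<G>_def by blast
        have "x $ j \<le> x $ b" if "j \<notin> A"
          by (rule mono) (use b j \<G>_def in blast)
        then show ?thesis using True x'A x'N by (cases "j \<in> A") auto
      next
        case False
        have "x $ b \<le> x $ i" by (rule mono) (use False b B_def \<G>_def in blast)
        moreover have "x $ j \<le> x $ i" by (rule mono) (use False ij \<G>_def in blast)
        ultimately show ?thesis using False x'A x'N by (cases "j \<in> A") auto
      qed
      then have "x' \<in> chain_cone \<G>" using less.hyps[OF card flag] by blast
      then obtain c where c: "x' = (\<Sum>F\<in>\<G>. c F *\<^sub>R flat_vector F)" "\<forall>F\<in>\<G> - {UNIV}. 0 \<le> c F"
        by (auto simp: chain_cone_def)
      let ?c = "c(A := x $ b - x $ a)"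
      have "(\<Sum>F\<in>\<F>. ?c F *\<^sub>R flat_vector F) = ?c A *\<^sub>R flat_vector A + (\<Sum>F\<in>\<G>. ?c F *\<^sub>R flat_vector F)"
        unfolding \<G>_def using A by (intro sum.remove) auto
      also have "(\<Sum>F\<in>\<G>. ?c F *\<^sub>R flat_vector F) = x'"
        unfolding c(1) by (rule sum.cong) (auto simp: \<G>_def)
      finally have "x = (\<Sum>F\<in>\<F>. ?c F *\<^sub>R flat_vector F)" by (simp add: x'_def)
      moreover have "\<forall>F\<in>\<F> - {UNIV}. 0 \<le> ?c F" using c(2) ba \<G>_def by auto
      ultimately show ?thesis unfolding chain_cone_def by blast
    qed
  qed
  then show "?P \<F> \<subseteq> chain_cone \<F>" using assms by blast
qed

lemma rational_polyhedron_chain_cone: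
  fixes \<F> :: "'n::finite set set"
  assumes "flag \<F>"
  shows "rational_polyhedron (chain_cone \<F>)"
proof -
  let ?I = "{(i, j). \<forall>F\<in>\<F>. i \<in> F \<longrightarrow> j \<in> F}"
  let ?H = "(\<lambda>(i, j). (axis j 1 - axis i 1 :: real^'n, 0::real)) ` ?I"
  have "chain_cone \<F> = {x. \<forall>(a, b)\<in>?H. a \<bullet> x \<le> b}"
    unfolding chain_cone_halfspaces[OF assms]
    by (auto simp: inner_diff_left inner_axis')
  moreover have "\<forall>(a, b)\<in>?H. integer_vec a" by (auto intro: integer_vec_diff integer_vec_axis)
  moreover have "finite ?H" by simp
  ultimately show ?thesis unfolding rational_polyhedron_def by blast
qed

text \<open>By the inequalities a sublevel set contains, with each index, the smallest member around
  it. It is thus a union of members, and a nonempty union of members of a finite chain is a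
  member.\<close>

lemma sublevel_set_mem_flag:
  assumes "flag \<F>" "x \<in> chain_cone \<F>" "{i. x $ i \<le> t} \<noteq> {}"
  shows "{i. x $ i \<le> t} \<in> \<F>"
proof -
  let ?S = "{i. x $ i \<le> t}" and ?m = "\<lambda>i. \<Inter>{F \<in> \<F>. i \<in> F}"
  have m: "?m i \<in> \<F>" for i
  proof -
    have "?m i \<in> {F \<in> \<F>. i \<in> F}"
      using assms(1) by (intro finite_chain_Inter_mem) (auto simp: flag_def chain_subset_def)
    then show ?thesis by blast
  qed
  have "?m i \<subseteq> ?S" if "i \<in> ?S" for i
  proof
    fix j assume "j \<in> ?m i"
    then have "x $ j \<le> x $ i" using assms(2) unfolding chain_cone_halfspaces[OF assms(1)] by blast
    with that show "j \<in> ?S" by simp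
  qed
  then have "?S = \<Union>(?m ` ?S)" by blast
  moreover have "\<Union>(?m ` ?S) \<in> ?m ` ?S"
  proof (rule finite_chain_Union_mem)
    show "chain\<^sub>\<subseteq> (?m ` ?S)" unfolding chain_subset_def
    proof (intro ballI)
      fix A B assume "A \<in> ?m ` ?S" "B \<in> ?m ` ?S"
      then have "A \<in> \<F>" "B \<in> \<F>" using m by blast+
      then show "A \<subseteq> B \<or> B \<subseteq> A" by (rule flag_linear[OF assms(1)])
    qed
  qed (use assms(3) in auto)
  ultimately show ?thesis using m by auto
qed

text \<open>\<open>F\<close> is the sublevel set of its own vector at level \<open>-1\<close>. The
  empty set is excluded because its vector is 0, which lies in every cone.\<close>

lemma flat_vector_mem_chain_coneD:
  assumes "flag \<F>" "flat_vector F \<in> chain_cone \<F>" "F \<noteq> {}"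
  shows "F \<in> \<F>"
proof -
  have "{i. flat_vector F $ i \<le> -1} = F" by (auto simp: flat_vector_nth)
  then show ?thesis using sublevel_set_mem_flag[OF assms(1,2), of "-1"] assms(3) by simp
qed

lemma chain_cone_mono:
  assumes "flag \<F>" "\<G> \<subseteq> \<F>"
  shows "chain_cone \<G> \<subseteq> chain_cone \<F>"
proof
  fix x assume "x \<in> chain_cone \<G>"
  then obtain c where c: "x = (\<Sum>F\<in>\<G>. c F *\<^sub>R flat_vector F)" "\<forall>F\<in>\<G> - {UNIV}. 0 \<le> c F"
    by (auto simp: chain_cone_def)
  have "x = (\<Sum>F\<in>\<F>. (if F \<in> \<G> then c F else 0) *\<^sub>R flat_vector F)"
    unfolding c(1) using assms(2) by (intro sum.mono_neutral_cong_left) auto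
  then show "x \<in> chain_cone \<F>" using c(2) unfolding chain_cone_def
    by (intro CollectI exI[of _ "\<lambda>F. if F \<in> \<G> then c F else 0"]) auto
qed

lemma chain_cone_subset_iff:
  assumes "flag \<F>" "flag \<G>"
  shows "chain_cone \<F> \<subseteq> chain_cone \<G> \<longleftrightarrow> \<F> \<subseteq> \<G>"
proof
  assume sub: "chain_cone \<F> \<subseteq> chain_cone \<G>"
  show "\<F> \<subseteq> \<G>"
  proof
    fix F assume "F \<in> \<F>"
    then show "F \<in> \<G>" using sub flat_vector_mem_chain_cone[OF assms(1)] assms
      by (intro flat_vector_mem_chain_coneD) (auto simp: flag_def)
  qed
qed (rule chain_cone_mono[OF assms(2)])

lemma chain_cone_eq_iff:
  assumes "flag \<F>" "flag \<G>"
  shows "chain_cone \<F> = chain_cone \<G> \<longleftrightarrow> \<F> = \<G>"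
  unfolding set_eq_subset chain_cone_subset_iff[OF assms] chain_cone_subset_iff[OF assms(2,1)] ..

section \<open>Faces and intersections of the cones\<close>

lemma flag_dual_span_eq_0:
  assumes "flag \<F>" "F \<in> \<F>" "F \<notin> \<G>" "\<G> \<subseteq> \<F>" "w \<in> span (flat_vector ` \<G>)"
  shows "flag_dual \<F> F \<bullet> w = 0"
  using assms(5)
proof (induction rule: span_induct)
  case base
  show ?case by (auto simp: subspace_def inner_add_right)
next
  case (step y)
  then show ?case using assms(1-4) by (auto simp: flag_dual_flat_vector)
qed

lemma chain_cone_subflag_iff:
  assumes "flag \<F>" "\<G> \<subseteq> \<F>" "UNIV \<in> \<G>"
  shows "x \<in> chain_cone \<G> \<longleftrightarrow> x \<in> chain_cone \<F> \<and> (\<forall>F\<in>\<F> - \<G>. flag_dual \<F> F \<bullet> x = 0)"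
proof (intro iffI conjI)
  assume x: "x \<in> chain_cone \<G>"
  then show "x \<in> chain_cone \<F>" using chain_cone_mono[OF assms(1,2)] by blast
  show "\<forall>F\<in>\<F> - \<G>. flag_dual \<F> F \<bullet> x = 0"
  proof
    fix F assume F: "F \<in> \<F> - \<G>"
    have "x \<in> span (flat_vector ` \<G>)"
      using x mem_chain_cone_iff[OF flag_subset[OF assms]] by blast
    then show "flag_dual \<F> F \<bullet> x = 0"
      using F assms(1,2) by (intro flag_dual_span_eq_0) auto
  qed
next
  assume x: "x \<in> chain_cone \<F> \<and> (\<forall>F\<in>\<F> - \<G>. flag_dual \<F> F \<bullet> x = 0)"
  have "x = (\<Sum>F\<in>\<F>. (flag_dual \<F> F \<bullet> x) *\<^sub>R flat_vector F)"
    using x span_flat_vectors_expansion[OF assms(1)] mem_chain_cone_iff[OF assms(1)] by blast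
  also have "\<dots> = (\<Sum>F\<in>\<G>. (flag_dual \<F> F \<bullet> x) *\<^sub>R flat_vector F)"
    using x assms(2) by (intro sum.mono_neutral_right) auto
  finally show "x \<in> chain_cone \<G>" using x assms mem_chain_cone_iff[OF assms(1), of x]
    unfolding chain_cone_def[of \<G>] by (intro CollectI exI[of _ "\<lambda>F. flag_dual \<F> F \<bullet> x"]) auto
qed

text \<open>A positive coefficient at \<open>F\<close> makes the coordinates of \<open>x\<close>
  jump at the boundary of \<open>F\<close>: they are at most \<open>- t\<close> on \<open>F\<close>
  and larger outside. So \<open>F\<close> is a sublevel set of \<open>x\<close>, a notion that does
  not refer to the flag and therefore transfers to \<G>.\<close>

lemma positive_coordinate_mem_flag:
  fixes \<F> \<G> :: "'n::finite set set"
  assumes "flag \<F>" "flag \<G>" "x \<in> chain_cone \<F>" "x \<in> chain_cone \<G>"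
    and F: "F \<in> \<F>" "F \<noteq> UNIV" "flag_dual \<F> F \<bullet> x > 0"
  shows "F \<in> \<G>"
proof -
  define c where "c = (\<lambda>G. flag_dual \<F> G \<bullet> x)"
  have x: "x = (\<Sum>G\<in>\<F>. c G *\<^sub>R flat_vector G)"
    unfolding c_def
    using assms(3) span_flat_vectors_expansion[OF assms(1)] mem_chain_cone_iff[OF assms(1)] by blast
  have pos: "0 \<le> c G" if "G \<in> \<F>" "G \<noteq> UNIV" for G
    unfolding c_def using that assms(3) mem_chain_cone_iff[OF assms(1), of x] by blast
  have cF: "0 < c F" using F unfolding c_def by simp
  have nth: "- x $ i = (\<Sum>G | G \<in> \<F> \<and> i \<in> G. c G)" for i
  proof -
    have "- x $ i = (\<Sum>G\<in>\<F>. if i \<in> G then c G else 0)"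
      unfolding x sum_component sum_negf[symmetric] by (rule sum.cong) (auto simp: flat_vector_nth)
    then show ?thesis by (simp add: sum.If_cases Int_def)
  qed
  define t where "t = (\<Sum>G | G \<in> \<F> \<and> F \<subseteq> G. c G)"
  have "x $ i \<le> - t" if "i \<in> F" for i
  proof -
    have "t \<le> (\<Sum>G | G \<in> \<F> \<and> i \<in> G. c G)"
      unfolding t_def using that pos by (intro sum_mono2) auto
    then show ?thesis using nth[of i] by simp
  qed
  moreover have "- t < x $ i" if "i \<notin> F" for i
  proof -
    have "(\<Sum>G | G \<in> \<F> \<and> i \<in> G. c G) \<le> (\<Sum>G | G \<in> \<F> \<and> F \<subset> G. c G)"
    proof (rule sum_mono2)
      show "{G \<in> \<F>. i \<in> G} \<subseteq> {G \<in> \<F>. F \<subset> G}"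
        using flag_linear[OF assms(1) F(1)] that by blast
    next
      \<comment> \<open>\<open>G\<close> misses \<open>i\<close>, hence is not \<open>UNIV\<close>,
        the only member whose coefficient may be negative.\<close>
      fix G assume "G \<in> {G \<in> \<F>. F \<subset> G} - {G \<in> \<F>. i \<in> G}"
      then show "0 \<le> c G" by (intro pos) auto
    qed simp
    also have "\<dots> < c F + (\<Sum>G | G \<in> \<F> \<and> F \<subset> G. c G)" using cF by simp
    also have "\<dots> = (\<Sum>G\<in>insert F {G \<in> \<F>. F \<subset> G}. c G)" by (subst sum.insert) auto
    also have "insert F {G \<in> \<F>. F \<subset> G} = {G \<in> \<F>. F \<subseteq> G}" using F by blast
    finally show ?thesis using nth[of i] unfolding t_def by linarith
  qed
  ultimately have "{i. x $ i \<le> - t} = F" by force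
  moreover have "F \<noteq> {}" using assms(1) F by (auto simp: flag_def)
  ultimately show ?thesis using sublevel_set_mem_flag[OF assms(2,4)] by metis
qed

text \<open>In a common point every member of \<F> outside \<G> has coefficient 0, since a positive
  one would force it into \<G>.\<close>

lemma chain_cone_Int:
  fixes \<F> \<G> :: "'n::finite set set"
  assumes "flag \<F>" "flag \<G>"
  shows "chain_cone \<F> \<inter> chain_cone \<G> = chain_cone (\<F> \<inter> \<G>)"
proof
  have U: "UNIV \<in> \<F> \<inter> \<G>" using assms by (auto simp: flag_def)
  show "chain_cone (\<F> \<inter> \<G>) \<subseteq> chain_cone \<F> \<inter> chain_cone \<G>"
    using assms by (auto intro: subsetD[OF chain_cone_mono, rotated 2])
  show "chain_cone \<F> \<inter> chain_cone \<G> \<subseteq> chain_cone (\<F> \<inter> \<G>)"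
  proof
    fix x assume x: "x \<in> chain_cone \<F> \<inter> chain_cone \<G>"
    have "flag_dual \<F> F \<bullet> x = 0" if "F \<in> \<F> - \<F> \<inter> \<G>" for F
    proof -
      have "F \<noteq> UNIV" using that U by blast
      then have "0 \<le> flag_dual \<F> F \<bullet> x" "\<not> 0 < flag_dual \<F> F \<bullet> x"
        using x that mem_chain_cone_iff[OF assms(1), of x] positive_coordinate_mem_flag[OF assms, of x F]
        by blast+
      then show ?thesis by simp
    qed
    then show "x \<in> chain_cone (\<F> \<inter> \<G>)"
      using chain_cone_subflag_iff[OF assms(1) _ U] x by auto
  qed
qed

text \<open>The dropped coordinates are nonnegative on the big cone, so they vanish at an interior
  point of a segment only if they vanish at both ends.\<close>

lemma chain_cone_face_of:
  assumes "flag \<F>" "\<G> \<subseteq> \<F>" "UNIV \<in> \<G>"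
  shows "chain_cone \<G> face_of chain_cone \<F>"
  unfolding face_of_def
proof (intro conjI ballI impI)
  show "chain_cone \<G> \<subseteq> chain_cone \<F>" using assms by (intro chain_cone_mono)
  show "convex (chain_cone \<G>)" using flag_subset[OF assms] by (rule convex_chain_cone)
  fix a b x
  assume ab: "a \<in> chain_cone \<F>" "b \<in> chain_cone \<F>" and x: "x \<in> chain_cone \<G>"
    and seg: "x \<in> open_segment a b"
  then obtain t where t: "0 < t" "t < 1" "x = (1 - t) *\<^sub>R a + t *\<^sub>R b" by (auto simp: in_segment)
  have "flag_dual \<F> F \<bullet> a = 0 \<and> flag_dual \<F> F \<bullet> b = 0" if F: "F \<in> \<F> - \<G>" for F
  proof -
    have "0 \<le> flag_dual \<F> F \<bullet> a" "0 \<le> flag_dual \<F> F \<bullet> b"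
      using F assms(3) ab mem_chain_cone_iff[OF assms(1)] by blast+
    moreover have "(1 - t) * (flag_dual \<F> F \<bullet> a) + t * (flag_dual \<F> F \<bullet> b) = 0"
      using F x chain_cone_subflag_iff[OF assms, of x] by (auto simp: t(3) inner_add_right)
    ultimately show ?thesis using t(1,2)
      by (simp add: add_nonneg_eq_0_iff)
  qed
  then show "a \<in> chain_cone \<G>" "b \<in> chain_cone \<G>"
    using ab chain_cone_subflag_iff[OF assms] by blast+
qed

text \<open>Let \<open>x\<close> in \<open>T\<close> have as many positive coordinates as possible.
  Averaging \<open>x\<close> with any point of \<open>T\<close> shows that no point of
  \<open>T\<close> has other positive coordinates; conversely, a segment from a point of the
  coordinate face to \<open>x\<close> can be prolonged inside the cone, so the face property pulls
  its starting point into \<open>T\<close>.\<close>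

lemma face_of_chain_cone:
  fixes \<F> :: "'n::finite set set"
  assumes "flag \<F>" "T face_of chain_cone \<F>" "T \<noteq> {}"
  obtains \<G> where "\<G> \<subseteq> \<F>" "UNIV \<in> \<G>" "T = chain_cone \<G>"
proof -
  define pos where "pos x = {F \<in> \<F> - {UNIV}. 0 < flag_dual \<F> F \<bullet> x}" for x
  have TF: "T \<subseteq> chain_cone \<F>" and "convex T" using assms(2) by (auto simp: face_of_def)
  obtain x where x: "x \<in> T" and max: "\<And>z. z \<in> T \<Longrightarrow> card (pos z) \<le> card (pos x)"
  proof -
    obtain x0 where "x0 \<in> T" using assms(3) by blast
    moreover have "\<forall>z. z \<in> T \<longrightarrow> card (pos z) < Suc (card (UNIV :: 'n set set))"
      by (intro allI impI le_imp_less_Suc card_mono) auto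
    ultimately have "\<exists>x. x \<in> T \<and> (\<forall>z. z \<in> T \<longrightarrow> card (pos z) \<le> card (pos x))"
      by (rule ex_has_greatest_nat)
    then show ?thesis using that by blast
  qed
  let ?\<G> = "insert UNIV (pos x)"
  have GF: "?\<G> \<subseteq> \<F>" "UNIV \<in> ?\<G>" using assms(1) by (auto simp: pos_def flag_def)
  have nonneg: "0 \<le> flag_dual \<F> F \<bullet> z" if "z \<in> chain_cone \<F>" "F \<in> \<F> - {UNIV}" for z F
    using that mem_chain_cone_iff[OF assms(1), of z] by blast
  have "T \<subseteq> chain_cone ?\<G>"
  proof
    fix z assume z: "z \<in> T"
    let ?m = "(1/2) *\<^sub>R x + (1/2) *\<^sub>R z"
    have m: "?m \<in> T" using \<open>convex T\<close> x z by (intro convexD) auto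
    have "pos x \<union> pos z \<subseteq> pos ?m"
    proof
      fix F assume F: "F \<in> pos x \<union> pos z"
      then have "F \<in> \<F> - {UNIV}" by (auto simp: pos_def)
      moreover from this have "0 \<le> flag_dual \<F> F \<bullet> x" "0 \<le> flag_dual \<F> F \<bullet> z"
        using nonneg x z TF by blast+
      ultimately show "F \<in> pos ?m" using F by (auto simp: pos_def inner_add_right)
    qed
    then have "card (pos x \<union> pos z) \<le> card (pos x)"
      using max[OF m] by (meson card_mono finite order_trans)
    then have "pos z \<subseteq> pos x"
      by (metis Un_upper1 Un_upper2 card_seteq finite)
    show "z \<in> chain_cone ?\<G>"
    proof -
      have "flag_dual \<F> F \<bullet> z = 0" if "F \<in> \<F> - ?\<G>" for F
      proof -
        have "F \<in> \<F> - {UNIV}" "F \<notin> pos z" using that \<open>pos z \<subseteq> pos x\<close> by blast+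
        moreover from this have "0 \<le> flag_dual \<F> F \<bullet> z" using nonneg z TF by blast
        ultimately show ?thesis by (simp add: pos_def)
      qed
      then show ?thesis using z TF chain_cone_subflag_iff[OF assms(1) GF, of z] by blast
    qed
  qed
  moreover have "chain_cone ?\<G> \<subseteq> T"
  proof
    fix y assume y: "y \<in> chain_cone ?\<G>"
    show "y \<in> T"
    proof (cases "y = x")
      case False
      have "\<exists>\<delta>>0. \<forall>F\<in>pos x. \<delta> * (flag_dual \<F> F \<bullet> y) \<le> flag_dual \<F> F \<bullet> x"
      proof -
        have "\<forall>\<^sub>F \<delta> in at_right 0. \<forall>F\<in>pos x. \<delta> * (flag_dual \<F> F \<bullet> y) \<le> flag_dual \<F> F \<bullet> x"
        proof (rule eventually_ball_finite, simp, intro ballI)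
          fix F assume "F \<in> pos x"
          have "((\<lambda>\<delta>. \<delta> * (flag_dual \<F> F \<bullet> y)) \<longlongrightarrow> 0 * (flag_dual \<F> F \<bullet> y)) (at_right 0)"
            by (intro tendsto_intros)
          moreover have "0 * (flag_dual \<F> F \<bullet> y) < flag_dual \<F> F \<bullet> x"
            using \<open>F \<in> pos x\<close> by (simp add: pos_def)
          ultimately have "\<forall>\<^sub>F \<delta> in at_right 0. \<delta> * (flag_dual \<F> F \<bullet> y) < flag_dual \<F> F \<bullet> x"
            by (rule order_tendstoD)
          then show "\<forall>\<^sub>F \<delta> in at_right 0. \<delta> * (flag_dual \<F> F \<bullet> y) \<le> flag_dual \<F> F \<bullet> x"
            by eventually_elim simp
        qed
        then have "\<forall>\<^sub>F \<delta> in at_right 0. \<delta> > 0 \<and>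
            (\<forall>F\<in>pos x. \<delta> * (flag_dual \<F> F \<bullet> y) \<le> flag_dual \<F> F \<bullet> x)"
          using eventually_at_right_less[of "0::real"] by eventually_elim simp
        then show ?thesis using eventually_happens' trivial_limit_at_right_real by blast
      qed
      then obtain \<delta> where \<delta>: "\<delta> > 0"
        "\<And>F. F \<in> pos x \<Longrightarrow> \<delta> * (flag_dual \<F> F \<bullet> y) \<le> flag_dual \<F> F \<bullet> x" by blast
      \<comment> \<open>Slightly beyond \<open>x\<close> on the line from \<open>y\<close>. The
        choice of \<delta> keeps the coordinates in \<open>pos x\<close> nonnegative; in the others,
        apart from \<open>UNIV\<close>, \<open>y\<close> vanishes.\<close>
      define z where "z = x + \<delta> *\<^sub>R (x - y)"
      have yF: "y \<in> chain_cone \<F>" using y chain_cone_mono[OF assms(1) GF(1)] by blast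
      have "0 \<le> flag_dual \<F> F \<bullet> z" if F: "F \<in> \<F> - {UNIV}" for F
      proof (cases "F \<in> pos x")
        case True
        then have "0 \<le> \<delta> * (flag_dual \<F> F \<bullet> x)" using \<delta>(1) by (auto simp: pos_def)
        with \<delta>(2)[OF True] show ?thesis by (simp add: z_def inner_add_right inner_diff_right algebra_simps)
      next
        case False
        then have "flag_dual \<F> F \<bullet> y = 0"
          using F y chain_cone_subflag_iff[OF assms(1) GF, of y] by blast
        then show ?thesis using \<delta>(1) nonneg[of x F] x TF F
          by (auto simp: z_def inner_add_right inner_diff_right)
      qed
      moreover have "z \<in> span (flat_vector ` \<F>)"
        unfolding z_def using x TF yF mem_chain_cone_iff[OF assms(1)]
        by (auto intro!: span_add span_scale span_diff)
      ultimately have zF: "z \<in> chain_cone \<F>" using mem_chain_cone_iff[OF assms(1)] by blast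
      let ?t = "1 / (1 + \<delta>)"
      have t: "?t * \<delta> = 1 - ?t" using \<delta>(1) by (simp add: field_simps)
      have "(1 - ?t) *\<^sub>R y + ?t *\<^sub>R z = x"
        unfolding z_def scaleR_add_right scaleR_scaleR t by (simp add: algebra_simps)
      moreover have "y \<noteq> z"
      proof -
        have "(1 + \<delta>) *\<^sub>R (x - y) = z - y" by (simp add: z_def scaleR_add_left)
        then show ?thesis using False \<delta>(1) by auto
      qed
      moreover have "0 < ?t" "?t < 1" using \<delta>(1) by auto
      ultimately have "x \<in> open_segment y z" unfolding in_segment by metis
      then show ?thesis using assms(2) yF zF x unfolding face_of_def by blast
    qed (use x in simp)
  qed
  ultimately show ?thesis using that GF by blast
qed

text \<open>Stated for any family closed under subflags, since it has to cover both a matroid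
  variety and the complex of a divisor, in which the longest flags are missing.\<close>

lemma polyhedral_complex_chain_cones:
  fixes \<Phi> :: "'n::finite set set set"
  assumes flag: "\<And>\<F>. \<F> \<in> \<Phi> \<Longrightarrow> flag \<F>"
    and sub: "\<And>\<F> \<G>. \<F> \<in> \<Phi> \<Longrightarrow> \<G> \<subseteq> \<F> \<Longrightarrow> UNIV \<in> \<G> \<Longrightarrow> \<G> \<in> \<Phi>"
  shows "polyhedral_complex (chain_cone ` \<Phi>)"
  unfolding polyhedral_complex_def
proof (intro conjI ballI allI impI)
  show "finite (chain_cone ` \<Phi>)" by simp
next
  fix \<sigma> assume "\<sigma> \<in> chain_cone ` \<Phi>"
  then show "\<sigma> \<noteq> {}" "rational_polyhedron \<sigma>"
    using flag zero_mem_chain_cone rational_polyhedron_chain_cone by blast+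
next
  fix \<sigma> \<tau> assume "\<sigma> \<in> chain_cone ` \<Phi>" and \<tau>: "\<tau> face_of \<sigma> \<and> \<tau> \<noteq> {}"
  then obtain \<F> where "\<F> \<in> \<Phi>" "\<sigma> = chain_cone \<F>" by blast
  moreover from this obtain \<G> where "\<G> \<subseteq> \<F>" "UNIV \<in> \<G>" "\<tau> = chain_cone \<G>"
    using face_of_chain_cone[of \<F> \<tau>] flag \<tau> by metis
  ultimately show "\<tau> \<in> chain_cone ` \<Phi>" using sub by blast
next
  fix \<sigma> \<tau> assume "\<sigma> \<in> chain_cone ` \<Phi>" "\<tau> \<in> chain_cone ` \<Phi>"
  then obtain \<F> \<G> where FG: "\<F> \<in> \<Phi>" "\<sigma> = chain_cone \<F>" "\<G> \<in> \<Phi>" "\<tau> = chain_cone \<G>" by blast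
  then have "UNIV \<in> \<F> \<inter> \<G>" using flag by (auto simp: flag_def)
  with FG flag show "(\<sigma> \<inter> \<tau>) face_of \<sigma>" "(\<sigma> \<inter> \<tau>) face_of \<tau>"
    by (auto simp: chain_cone_Int intro!: chain_cone_face_of)
qed

section \<open>Rank functions\<close>

text \<open>The Higgs interpolants are given by their ranks, so matroids are treated through rank
  functions; independent sets reappear only at the end, to verify these axioms for
  \<open>matroid_rank\<close>. Unit increase follows from submodularity and
  \<open>rank_singleton\<close>.\<close>

locale loopfree_rank =
  fixes r :: "'n::finite set \<Rightarrow> nat"
  assumes rank_empty: "r {} = 0"
    and rank_singleton: "r {x} = 1"
    and rank_insert_mono: "r A \<le> r (insert x A)"
    and submodular: "r (A \<union> B) + r (A \<inter> B) \<le> r A + r B"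

definition rank_flats :: "('n set \<Rightarrow> nat) \<Rightarrow> 'n set set" where
  "rank_flats r = {F. \<forall>x. x \<notin> F \<longrightarrow> r F < r (insert x F)}"

definition flat_flags :: "('n set \<Rightarrow> nat) \<Rightarrow> 'n set set set" where
  "flat_flags r = {\<F>. flag \<F> \<and> \<F> \<subseteq> rank_flats r}"

context loopfree_rank
begin

lemma rank_mono: "A \<subseteq> B \<Longrightarrow> r A \<le> r B"
proof -
  have "r A \<le> r (A \<union> C)" if "finite C" for C
    using that
  proof (induction C)
    case (insert x C)
    then show ?case using rank_insert_mono[of "A \<union> C" x] by simp
  qed simp
  then show "A \<subseteq> B \<Longrightarrow> r A \<le> r B" by (metis finite sup.absorb_iff2)
qed

lemma rank_insert_le: "r (insert x A) \<le> Suc (r A)"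
  using submodular[of A "{x}"] rank_singleton[of x] by simp

lemma rank_union_absorb:
  assumes "\<And>x. x \<in> B \<Longrightarrow> r (insert x A) = r A"
  shows "r (A \<union> B) = r A"
proof -
  have "finite B" by simp
  then show ?thesis using assms
  proof (induction B)
    case (insert x B)
    have "r (insert x A \<union> (A \<union> B)) + r (insert x A \<inter> (A \<union> B)) \<le> r (insert x A) + r (A \<union> B)"
      by (rule submodular)
    moreover have "insert x A \<union> (A \<union> B) = A \<union> insert x B" by blast
    moreover have "r A \<le> r (insert x A \<inter> (A \<union> B))" "r A \<le> r (A \<union> insert x B)"
      by (intro rank_mono; blast)+
    ultimately show ?case using insert by simp
  qed simp
qed

section \<open>Closure and flats of a rank function\<close>

definition rank_closure :: "'n set \<Rightarrow> 'n set" where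
  "rank_closure A = {x. r (insert x A) = r A}"

lemma closure_superset: "A \<subseteq> rank_closure A"
  by (auto simp: rank_closure_def insert_absorb)

lemma rank_of_closure: "r (rank_closure A) = r A"
  using rank_union_absorb[of "rank_closure A" A] closure_superset[of A]
  by (simp add: rank_closure_def sup.absorb2)

lemma closure_flat: "rank_closure A \<in> rank_flats r"
  unfolding rank_flats_def
proof (intro CollectI allI impI)
  fix x assume "x \<notin> rank_closure A"
  then have "r A < r (insert x A)"
    using rank_insert_mono[of A x] by (auto simp: rank_closure_def)
  also have "\<dots> \<le> r (insert x (rank_closure A))"
    using closure_superset[of A] by (intro rank_mono) blast
  finally show "r (rank_closure A) < r (insert x (rank_closure A))" by (simp add: rank_of_closure)
qed

lemma flat_rank_strict:
  assumes "F \<in> rank_flats r" "F \<subset> G"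
  shows "r F < r G"
proof -
  obtain x where x: "x \<in> G" "x \<notin> F" using assms(2) by blast
  then have "r F < r (insert x F)" using assms(1) by (auto simp: rank_flats_def)
  also have "\<dots> \<le> r G" using x assms(2) by (intro rank_mono) blast
  finally show ?thesis .
qed

text \<open>Submodularity makes marginal gains decrease: an element that adds nothing to
  \<open>A\<close> adds nothing to the larger set \<open>F\<close>, so it already lies in the flat
  \<open>F\<close>.\<close>

lemma closure_subset_flat:
  assumes "F \<in> rank_flats r" "A \<subseteq> F"
  shows "rank_closure A \<subseteq> F"
proof
  fix x assume x: "x \<in> rank_closure A"
  show "x \<in> F"
  proof (rule ccontr)
    assume "x \<notin> F"
    then have "r F < r (insert x F)" using assms(1) by (auto simp: rank_flats_def)
    moreover have "r (insert x A \<union> F) + r (insert x A \<inter> F) \<le> r (insert x A) + r F" by (rule submodular)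
    moreover have "insert x A \<union> F = insert x F" using assms(2) by blast
    moreover have "r A \<le> r (insert x A \<inter> F)" using assms(2) by (intro rank_mono) blast
    ultimately show False using x by (simp add: rank_closure_def)
  qed
qed

text \<open>Looplessness makes the empty set a flat, so it can serve as a virtual bottom member
  below every flag.\<close>

lemma empty_flat: "{} \<in> rank_flats r"
  by (simp add: rank_flats_def rank_empty rank_singleton)

lemma UNIV_flat: "UNIV \<in> rank_flats r"
  by (simp add: rank_flats_def)

lemma cover_rank:
  assumes "F \<in> rank_flats r" "x \<notin> F"
  shows "r (insert x F) = Suc (r F)"
proof -
  have "r F < r (insert x F)" using assms by (auto simp: rank_flats_def)
  then show ?thesis using rank_insert_le[of x F] by simp
qed

section \<open>Flags of flats and their gaps\<close>

lemma flat_flagsD: "\<F> \<in> flat_flags r \<Longrightarrow> flag \<F>" "\<F> \<in> flat_flags r \<Longrightarrow> F \<in> \<F> \<Longrightarrow> F \<in> rank_flats r"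
  by (auto simp: flat_flags_def)

lemma flat_flags_subset: "\<F> \<in> flat_flags r \<Longrightarrow> \<G> \<subseteq> \<F> \<Longrightarrow> UNIV \<in> \<G> \<Longrightarrow> \<G> \<in> flat_flags r"
  using flag_subset[of \<F> \<G>] by (auto simp: flat_flags_def)

lemma flag_rank_le_imp_subset:
  assumes "\<F> \<in> flat_flags r" "F \<in> insert {} \<F>" "G \<in> insert {} \<F>" "r F \<le> r G"
  shows "F \<subseteq> G"
proof (rule ccontr)
  assume "\<not> F \<subseteq> G"
  then have "G \<subset> F" "G \<in> rank_flats r"
    using assms(1-3) flag_linear[of \<F> F G] empty_flat by (auto simp: flat_flags_def)
  then show False using flat_rank_strict[of G F] assms(4) by simp
qed

lemma card_flat_flag_le:
  assumes "\<F> \<in> flat_flags r"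
  shows "card \<F> \<le> r UNIV"
proof -
  have "inj_on r \<F>"
    using flag_rank_le_imp_subset[OF assms] by (intro inj_onI subset_antisym) auto
  moreover have "r ` \<F> \<subseteq> {1..r UNIV}"
  proof (intro image_subsetI)
    fix F assume "F \<in> \<F>"
    then have "{} \<subset> F" using assms by (auto simp: flat_flags_def flag_def)
    then show "r F \<in> {1..r UNIV}"
      using flat_rank_strict[OF empty_flat, of F] rank_mono[of F UNIV] by simp
  qed
  ultimately show ?thesis using card_inj_on_le[of r \<F> "{1..r UNIV}"] by simp
qed

text \<open>Pigeonhole: together with the empty set the flag still has too few members to realise
  all ranks from 0 to \<open>r UNIV\<close>. \<open>A\<close> and \<open>B\<close> are its
  neighbours of a missed rank \<open>j\<close>.\<close>

lemma flat_flag_gap: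
  assumes \<F>: "\<F> \<in> flat_flags r" and card: "card \<F> < r UNIV"
  obtains A B where "A \<in> insert {} \<F>" "B \<in> \<F>" "r A + 2 \<le> r B"
    "\<And>F. F \<in> \<F> \<Longrightarrow> F \<subseteq> A \<or> B \<subseteq> F"
proof -
  let ?\<E> = "insert {} \<F>"
  have flag: "flag \<F>" using \<F> by (rule flat_flagsD)
  have "card (r ` ?\<E>) \<le> card ?\<E>" by (intro card_image_le) simp
  also have "\<dots> \<le> Suc (card \<F>)" by (intro card_insert_le_m1) auto
  also have "\<dots> < card {0..r UNIV}" using card by simp
  finally have less: "card (r ` ?\<E>) < card {0..r UNIV}" .
  have "\<not> {0..r UNIV} \<subseteq> r ` ?\<E>"
  proof
    assume "{0..r UNIV} \<subseteq> r ` ?\<E>"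
    then have "card {0..r UNIV} \<le> card (r ` ?\<E>)" by (intro card_mono) simp_all
    from leD[OF this] less show False by (rule notE)
  qed
  then obtain j where "j \<in> {0..r UNIV}" and j2: "j \<notin> r ` ?\<E>" by blast
  then have j: "j \<le> r UNIV" "j \<notin> r ` ?\<E>" by (simp_all only: atLeastAtMost_iff simp_thms)
  define A where "A = \<Union>{F \<in> ?\<E>. r F < j}"
  define B where "B = \<Inter>{F \<in> \<F>. j < r F}"
  have j0: "0 < j" using j(2) rank_empty by auto
  have chain: "chain\<^sub>\<subseteq> ?\<E>" using flag by (auto simp: flag_def chain_subset_def)
  have A: "A \<in> {F \<in> ?\<E>. r F < j}"
    unfolding A_def using chain j0 rank_empty
    by (intro finite_chain_Union_mem) (auto simp: chain_subset_def)
  have U: "UNIV \<in> \<F>" using flag by (simp add: flag_def)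
  then have "r UNIV \<noteq> j" using j(2) by blast
  then have B: "B \<in> {F \<in> \<F>. j < r F}"
    unfolding B_def using chain j(1) U
    by (intro finite_chain_Inter_mem) (auto simp: chain_subset_def)
  show ?thesis
  proof (rule that)
    show "A \<in> insert {} \<F>" "B \<in> \<F>" "r A + 2 \<le> r B" using A B by auto
    fix F assume F: "F \<in> \<F>"
    then have "r F \<noteq> j" using j(2) by blast
    then have "r F < j \<or> j < r F" by linarith
    then show "F \<subseteq> A \<or> B \<subseteq> F" using F unfolding A_def B_def by blast
  qed
qed

lemma insert_gap_flat_flag:
  assumes "\<F> \<in> flat_flags r" "\<And>F. F \<in> \<F> \<Longrightarrow> F \<subseteq> A \<or> B \<subseteq> F"
    and "G \<in> rank_flats r" "A \<subset> G" "G \<subset> B"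
  shows "insert G \<F> \<in> flat_flags r" "G \<notin> \<F>"
proof -
  have "F \<subseteq> G \<or> G \<subseteq> F" if "F \<in> \<F>" for F using assms(2)[OF that] assms(4,5) by blast
  then show "insert G \<F> \<in> flat_flags r"
    using assms(1,3,4) by (auto simp: flat_flags_def flag_def chain_subset_def)
  show "G \<notin> \<F>" using assms(2,4,5) by blast
qed

lemma gap_flat:
  assumes "A \<in> rank_flats r" "B \<in> rank_flats r" "r A + 2 \<le> r B" "x \<in> B" "x \<notin> A" "A \<subseteq> B"
  defines "G \<equiv> rank_closure (insert x A)"
  shows "G \<in> rank_flats r" "A \<subset> G" "G \<subset> B" "r G = Suc (r A)" "x \<in> G"
proof -
  show r: "r G = Suc (r A)" using cover_rank[OF assms(1,5)] by (simp add: G_def rank_of_closure)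
  show "G \<in> rank_flats r" "x \<in> G" "A \<subset> G"
    using closure_flat closure_superset[of "insert x A"] assms(5) by (auto simp: G_def)
  have "G \<subseteq> B" using assms closure_subset_flat[of B "insert x A"] by simp
  moreover have "G \<noteq> B" using assms(3) r by auto
  ultimately show "G \<subset> B" by blast
qed

lemma flat_flag_extend:
  assumes "\<F> \<in> flat_flags r" "card \<F> < r UNIV"
  obtains G where "insert G \<F> \<in> flat_flags r" "G \<notin> \<F>"
proof -
  obtain A B where AB: "A \<in> insert {} \<F>" "B \<in> \<F>" "r A + 2 \<le> r B"
    "\<And>F. F \<in> \<F> \<Longrightarrow> F \<subseteq> A \<or> B \<subseteq> F" by (rule flat_flag_gap[OF assms]) blast
  then have flats: "A \<in> rank_flats r" "B \<in> rank_flats r" using assms(1) empty_flat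
    by (auto simp: flat_flags_def)
  have "A \<subset> B" using AB flag_rank_le_imp_subset[OF assms(1), of A B] by auto
  then obtain x where x: "x \<in> B" "x \<notin> A" by blast
  note G = gap_flat[OF flats AB(3) x]
  show ?thesis
    using that insert_gap_flat_flag[OF assms(1) AB(4) G(1-3)] \<open>A \<subset> B\<close> by blast
qed

text \<open>Supplies purity twice: with \<open>m = r UNIV\<close> for the variety, and with
  \<open>m\<close> one less for the divisor.\<close>

lemma flat_flag_extend_card:
  assumes "\<F> \<in> flat_flags r" "card \<F> \<le> m" "m \<le> r UNIV"
  shows "\<exists>\<G>\<in>flat_flags r. \<F> \<subseteq> \<G> \<and> card \<G> = m"
  using assms
proof (induction "m - card \<F>" arbitrary: \<F>)
  case 0
  then show ?case by auto
next
  case (Suc d)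
  then have "card \<F> < r UNIV" by simp
  then obtain G where G: "insert G \<F> \<in> flat_flags r" "G \<notin> \<F>" by (rule flat_flag_extend[OF Suc.prems(1)])
  then have "card (insert G \<F>) = Suc (card \<F>)" by simp
  moreover have "card \<F> < m" using Suc.hyps(2) by simp
  ultimately have "\<exists>\<G>\<in>flat_flags r. insert G \<F> \<subseteq> \<G> \<and> card \<G> = m"
    using Suc.hyps(2) Suc.prems(3) G(1) by (intro Suc.hyps(1)) auto
  then show ?case by blast
qed

definition gap_flats :: "'n set \<Rightarrow> 'n set \<Rightarrow> 'n set set" where
  "gap_flats A B = {G \<in> rank_flats r. A \<subset> G \<and> G \<subset> B}"

text \<open>The local picture at a ridge: a single rank is missing, and the facets above correspond
  to the flats that fit between \<open>A\<close> and \<open>B\<close>. \<open>A\<close> may be the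
  virtual bottom member, which does not belong to the flag.\<close>

definition flag_gap :: "'n set set \<Rightarrow> 'n set \<Rightarrow> 'n set \<Rightarrow> bool" where
  "flag_gap \<F> A B \<longleftrightarrow> A \<in> insert {} \<F> \<and> B \<in> \<F> \<and> A \<subset> B \<and> r B = r A + 2 \<and>
    A \<in> rank_flats r \<and> B \<in> rank_flats r \<and> (\<forall>F\<in>\<F>. F \<subseteq> A \<or> B \<subseteq> F) \<and>
    (\<forall>G\<in>gap_flats A B. insert G \<F> \<in> flat_flags r \<and> G \<notin> \<F>) \<and>
    {\<G> \<in> flat_flags r. \<F> \<subset> \<G> \<and> card \<G> = r UNIV} = (\<lambda>G. insert G \<F>) ` gap_flats A B"

lemma ridge_has_gap:
  assumes \<F>: "\<F> \<in> flat_flags r" and card: "Suc (card \<F>) = r UNIV"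
  shows "\<exists>A B. flag_gap \<F> A B"
proof -
  obtain A B where AB: "A \<in> insert {} \<F>" "B \<in> \<F>" "r A + 2 \<le> r B"
    "\<And>F. F \<in> \<F> \<Longrightarrow> F \<subseteq> A \<or> B \<subseteq> F" using flat_flag_gap[OF \<F>] card by (metis lessI)
  then have flats: "A \<in> rank_flats r" "B \<in> rank_flats r" using \<F> empty_flat
    by (auto simp: flat_flags_def)
  have "A \<subset> B" using AB flag_rank_le_imp_subset[OF \<F>, of A B] by auto
  then obtain x where x: "x \<in> B" "x \<notin> A" by blast
  define H where "H = rank_closure (insert x A)"
  have H: "H \<in> rank_flats r" "A \<subset> H" "H \<subset> B" "r H = Suc (r A)"
    using gap_flat[OF flats AB(3) x] \<open>A \<subset> B\<close> by (auto simp: H_def)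
  have HF: "insert H \<F> \<in> flat_flags r" "H \<notin> \<F>"
    using insert_gap_flat_flag[OF \<F> AB(4) H(1-3)] by blast+
  \<comment> \<open>A wider gap would admit two new flats \<open>H\<close> and \<open>K\<close>,
    hence a flag with more members than the rank allows.\<close>
  have rB: "r B = r A + 2"
  proof (rule ccontr)
    assume "r B \<noteq> r A + 2"
    then have 3: "r H + 2 \<le> r B" using AB(3) H(4) by simp
    obtain y where y: "y \<in> B" "y \<notin> H" using H(3) by blast
    define K where "K = rank_closure (insert y H)"
    have K: "K \<in> rank_flats r" "H \<subset> K" "K \<subset> B"
      using gap_flat[OF H(1) flats(2) 3 y] H(3) by (auto simp: K_def)
    have "F \<subseteq> H \<or> B \<subseteq> F" if "F \<in> insert H \<F>" for F using that AB(4) H(2) by blast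
    from insert_gap_flat_flag[OF HF(1) this K]
    have "insert K (insert H \<F>) \<in> flat_flags r" "K \<notin> insert H \<F>" by blast+
    then show False using card_flat_flag_le[of "insert K (insert H \<F>)"] HF(2) card by simp
  qed
  have ins: "insert G \<F> \<in> flat_flags r \<and> card (insert G \<F>) = r UNIV \<and> G \<notin> \<F>" if "G \<in> gap_flats A B" for G
    using insert_gap_flat_flag[OF \<F> AB(4), of G] that card by (auto simp: gap_flats_def)
  have del: "\<exists>G\<in>gap_flats A B. \<G> = insert G \<F>"
    if G: "\<G> \<in> flat_flags r" "\<F> \<subset> \<G>" "card \<G> = r UNIV" for \<G>
  proof -
    have "card (\<G> - \<F>) = 1" using G card by (subst card_Diff_subset) auto
    then obtain G where GF: "\<G> - \<F> = {G}" by (rule card_1_singletonE)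
    then have eq: "\<G> = insert G \<F>" using G(2) by blast
    have Gflat: "G \<in> rank_flats r" and "G \<notin> \<F>" using GF G(1) by (auto simp: flat_flags_def)
    \<comment> \<open>\<G> is already full. Had \<open>G\<close> been added outside the gap,
      \<open>H\<close> would still fit into \<G>.\<close>
    have "insert H \<G> \<notin> flat_flags r \<or> H \<in> \<G>"
      using card_flat_flag_le[of "insert H \<G>"] G(3) by (auto simp: card_insert_if split: if_splits)
    moreover have "insert H \<G> \<in> flat_flags r \<and> H \<notin> \<G>" if "G \<subseteq> A \<or> B \<subseteq> G"
      using insert_gap_flat_flag[OF G(1) _ H(1-3)] AB(4) that unfolding eq by blast
    ultimately have "\<not> (G \<subseteq> A \<or> B \<subseteq> G)" by blast
    moreover have "A \<subseteq> G \<or> G \<subseteq> A" "B \<subseteq> G \<or> G \<subseteq> B"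
      using AB(1,2) flag_linear[OF flat_flagsD(1)[OF G(1)], of _ G] unfolding eq by blast+
    ultimately have "G \<in> gap_flats A B" using Gflat by (auto simp: gap_flats_def)
    then show ?thesis using eq by blast
  qed
  have "{\<G> \<in> flat_flags r. \<F> \<subset> \<G> \<and> card \<G> = r UNIV} = (\<lambda>G. insert G \<F>) ` gap_flats A B"
    (is "?L = ?R")
  proof (intro subset_antisym subsetI)
    fix \<G> assume "\<G> \<in> ?L"
    then show "\<G> \<in> ?R" using del[of \<G>] by blast
  next
    fix \<G> assume "\<G> \<in> ?R"
    then show "\<G> \<in> ?L" using ins by blast
  qed
  then have "flag_gap \<F> A B"
    unfolding flag_gap_def using AB(1,2,4) ins \<open>A \<subset> B\<close> rB flats by simp
  then show ?thesis by blast
qed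

text \<open>A flat of the gap containing \<open>x\<close> contains the closure of
  \<open>insert x A\<close>, whose rank \<open>r A + 1\<close> is the only one available strictly
  inside the gap; equal ranks force equality.\<close>

lemma gap_flats_unique:
  assumes "A \<in> rank_flats r" "B \<in> rank_flats r" "A \<subset> B" "r B = r A + 2" "x \<in> B" "x \<notin> A"
  shows "{G \<in> gap_flats A B. x \<in> G} = {rank_closure (insert x A)}"
proof -
  have "rank_closure (insert x A) \<in> gap_flats A B" "x \<in> rank_closure (insert x A)"
    using gap_flat[OF assms(1,2) _ assms(5,6)] assms(3,4) by (auto simp: gap_flats_def)
  moreover have "G = rank_closure (insert x A)" if "G \<in> gap_flats A B" "x \<in> G" for G
  proof -
    have G: "G \<in> rank_flats r" "A \<subset> G" "G \<subset> B" using that by (auto simp: gap_flats_def)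
    have "rank_closure (insert x A) \<subseteq> G" using G that by (intro closure_subset_flat) auto
    moreover have "r G < r B" using flat_rank_strict G by blast
    moreover have "r (rank_closure (insert x A)) = Suc (r A)"
      using cover_rank[OF assms(1,6)] by (simp add: rank_of_closure)
    ultimately show ?thesis
      using flat_rank_strict[OF closure_flat[of "insert x A"], of G] assms(4) by (cases "rank_closure (insert x A) = G") auto
  qed
  ultimately show ?thesis by blast
qed

text \<open>Coordinatewise count: an index in \<open>A\<close> lies in every flat of the gap, an
  index in \<open>B - A\<close> in exactly one, and the others in none.\<close>

lemma sum_gap_flat_vectors:
  assumes "A \<in> rank_flats r" "B \<in> rank_flats r" "A \<subset> B" "r B = r A + 2"
  shows "(\<Sum>G\<in>gap_flats A B. flat_vector G)
    = flat_vector B + (real (card (gap_flats A B)) - 1) *\<^sub>R flat_vector A"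
proof (simp add: vec_eq_iff, rule allI)
  fix i
  have "(\<Sum>G\<in>gap_flats A B. flat_vector G $ i) = - real (card {G \<in> gap_flats A B. i \<in> G})"
    by (simp add: flat_vector_nth sum_negf of_bool_def sum.If_cases Int_def)
  also have "\<dots> = flat_vector B $ i + (real (card (gap_flats A B)) - 1) * flat_vector A $ i"
  proof -
    consider "i \<in> A" | "i \<in> B" "i \<notin> A" | "i \<notin> B" by blast
    then show ?thesis
    proof cases
      case 1
      then have "{G \<in> gap_flats A B. i \<in> G} = gap_flats A B" by (auto simp: gap_flats_def)
      then show ?thesis using 1 assms(3) by (auto simp: flat_vector_nth)
    next
      case 2
      then show ?thesis using gap_flats_unique[OF assms] by (simp add: flat_vector_nth)
    next
      case 3
      then have "{G \<in> gap_flats A B. i \<in> G} = {}" by (auto simp: gap_flats_def)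
      then show ?thesis using 3 assms(3) by (auto simp: flat_vector_nth)
    qed
  qed
  finally show "(\<Sum>G\<in>gap_flats A B. flat_vector G $ i)
    = flat_vector B $ i + (real (card (gap_flats A B)) - 1) * flat_vector A $ i" .
qed

end

section \<open>Linear parts and normal vectors\<close>

lemma span_insert_flag:
  assumes "flag (insert G \<F>)" "G \<notin> \<F>" "w \<in> span (flat_vector ` insert G \<F>)"
  shows "w - (flag_dual (insert G \<F>) G \<bullet> w) *\<^sub>R flat_vector G \<in> span (flat_vector ` \<F>)"
proof -
  let ?c = "\<lambda>F. flag_dual (insert G \<F>) F \<bullet> w"
  have "w = (\<Sum>F\<in>insert G \<F>. ?c F *\<^sub>R flat_vector F)"
    using span_flat_vectors_expansion[OF assms(1,3)] .
  also have "\<dots> = ?c G *\<^sub>R flat_vector G + (\<Sum>F\<in>\<F>. ?c F *\<^sub>R flat_vector F)"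
    using assms(2) by simp
  finally have "w - ?c G *\<^sub>R flat_vector G = (\<Sum>F\<in>\<F>. ?c F *\<^sub>R flat_vector F)"
    by (simp add: algebra_simps)
  also have "\<dots> \<in> span (flat_vector ` \<F>)" by (intro span_sum span_scale span_base imageI)
  finally show ?thesis .
qed

text \<open>The functional \<open>u\<close> is integral, is 1 on \<open>flat_vector G\<close> and 0
  on the span of the ridge, so \<open>flat_vector G\<close> is a primitive normal vector. For any
  other one, \<open>v\<close>, the vector of \<open>G\<close> is an integer multiple of
  \<open>v\<close> modulo that span, so \<open>u \<bullet> v\<close> is a unit of the integers; it
  is nonnegative because \<open>v\<close> points into the facet.\<close>

lemma normal_vector_flag:
  fixes \<F> :: "'n::finite set set"
  assumes flag: "flag (insert G \<F>)" and G: "G \<notin> \<F>" and U: "UNIV \<in> \<F>"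
  shows "normal_vector (chain_cone (insert G \<F>)) (chain_cone \<F>) - flat_vector G
    \<in> span (flat_vector ` \<F>)"
proof -
  let ?\<sigma> = "chain_cone (insert G \<F>)" and ?\<tau> = "chain_cone \<F>"
  define u where "u = flag_dual (insert G \<F>) G"
  have flag': "flag \<F>" using flag_subset[OF flag _ U] by blast
  have u_int: "integer_vec u" unfolding u_def using integer_vec_flag_dual[OF flag] by simp
  have uG: "u \<bullet> flat_vector G = 1" unfolding u_def using flag_dual_flat_vector[OF flag] by simp
  have u0: "u \<bullet> w = 0" if "w \<in> span (flat_vector ` \<F>)" for w
    unfolding u_def using flag_dual_span_eq_0[OF flag _ G _ that] by blast
  note dir = direction_chain_cone[OF flag] direction_chain_cone[OF flag']
  have rest: "w - (u \<bullet> w) *\<^sub>R flat_vector G \<in> direction ?\<tau>" if "w \<in> direction ?\<sigma>" for w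
    using span_insert_flag[OF flag G, of w] that unfolding dir u_def .
  have "primitive_normal ?\<sigma> ?\<tau> (flat_vector G)"
    unfolding primitive_normal_def
  proof (intro conjI allI impI)
    show "integer_vec (flat_vector G)" by (rule integer_vec_flat_vector)
    show "flat_vector G \<in> direction ?\<sigma>" unfolding dir by (intro span_base imageI) simp
    show "\<exists>x\<in>?\<tau>. \<exists>\<epsilon>>0. x + \<epsilon> *\<^sub>R flat_vector G \<in> ?\<sigma>"
      using zero_mem_chain_cone[of \<F>] flat_vector_mem_chain_cone[OF flag, of G]
      by (intro bexI[of _ 0] exI[of _ 1]) auto
    fix w assume w: "integer_vec w \<and> w \<in> direction ?\<sigma>"
    then obtain m where "u \<bullet> w = of_int m" using integer_vec_inner[OF u_int, of w] by (auto elim: Ints_cases)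
    then show "\<exists>m::int. w - of_int m *\<^sub>R flat_vector G \<in> direction ?\<tau>"
      using rest[of w] w by (intro exI[of _ m]) simp
  qed
  then have "primitive_normal ?\<sigma> ?\<tau> (normal_vector ?\<sigma> ?\<tau>)"
    unfolding normal_vector_def by (rule someI)
  moreover have "v - flat_vector G \<in> span (flat_vector ` \<F>)" if v: "primitive_normal ?\<sigma> ?\<tau> v" for v
  proof -
    have vs: "v \<in> direction ?\<sigma>" and vi: "integer_vec v" using v by (auto simp: primitive_normal_def)
    have "integer_vec (flat_vector G) \<and> flat_vector G \<in> direction ?\<sigma>"
      unfolding dir by (auto intro: integer_vec_flat_vector span_base)
    then obtain m :: int where "flat_vector G - of_int m *\<^sub>R v \<in> direction ?\<tau>"
      using v unfolding primitive_normal_def by blast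
    then have m: "of_int m * (u \<bullet> v) = 1" using u0 uG unfolding dir by (force simp: inner_diff_right)
    obtain c :: int where c: "u \<bullet> v = of_int c" using integer_vec_inner[OF u_int vi] by (auto elim: Ints_cases)
    obtain x \<epsilon> where x: "x \<in> ?\<tau>" "\<epsilon> > 0" "x + \<epsilon> *\<^sub>R v \<in> ?\<sigma>"
      using v by (auto simp: primitive_normal_def)
    have "G \<noteq> UNIV" using G U by blast
    then have "0 \<le> u \<bullet> (x + \<epsilon> *\<^sub>R v)" using x(3) mem_chain_cone_iff[OF flag] by (auto simp: u_def)
    moreover have "u \<bullet> x = 0" using x(1) u0 mem_chain_cone_iff[OF flag'] by blast
    ultimately have "0 \<le> c" using x(2) c by (simp add: inner_add_right zero_le_mult_iff)
    moreover have "real_of_int (m * c) = 1" using m c by simp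
    then have "m * c = 1" by linarith
    ultimately have "c = 1" using zmult_eq_1_iff by auto
    then show ?thesis using rest[OF vs] c unfolding dir by simp
  qed
  ultimately show ?thesis by blast
qed

text \<open>Two affine expressions for \<phi> on \<sigma> have the same increments, so the chosen
  covector may be replaced by any convenient one on the direction space.\<close>

lemma linear_part_eq:
  assumes "integer_affine_on \<sigma> \<phi> a" "v \<in> direction \<sigma>"
  shows "linear_part \<phi> \<sigma> v = a \<bullet> v"
proof -
  define b where "b = (SOME a. integer_affine_on \<sigma> \<phi> a)"
  have "integer_affine_on \<sigma> \<phi> b" unfolding b_def using assms(1) by (rule someI)
  then obtain c d where cd: "\<And>x. x \<in> \<sigma> \<Longrightarrow> \<phi> x = a \<bullet> x + c" "\<And>x. x \<in> \<sigma> \<Longrightarrow> \<phi> x = b \<bullet> x + d"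
    using assms(1) unfolding integer_affine_on_def by metis
  from assms(2) have "b \<bullet> v = a \<bullet> v" unfolding direction_def
  proof (induction rule: span_induct)
    case base
    show ?case by (auto simp: subspace_def inner_add_right)
  next
    case (step w)
    then obtain x y where xy: "x \<in> \<sigma>" "y \<in> \<sigma>" "w = x - y" by blast
    then have "a \<bullet> x + c = b \<bullet> x + d" "a \<bullet> y + c = b \<bullet> y + d" using cd by metis+
    then show ?case by (simp add: xy(3) inner_diff_right)
  qed
  then show ?thesis by (simp add: linear_part_def b_def)
qed

lemma linear_linear_part: "linear (linear_part \<phi> \<sigma>)"
  by (simp add: linear_iff linear_part_def inner_add_right)

section \<open>The function cutting out an up-set of flats\<close>

text \<open>The conditions on \<open>UNIV\<close> and \<open>{}\<close> keep the minimum and the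
  maxima of \<open>cut_function\<close> away from empty sets.\<close>

definition proper_up_set :: "'a set set \<Rightarrow> bool" where
  "proper_up_set \<U> \<longleftrightarrow> UNIV \<in> \<U> \<and> {} \<notin> \<U> \<and> (\<forall>A\<in>\<U>. \<forall>B. A \<subseteq> B \<longrightarrow> B \<in> \<U>)"

text \<open>Up to sign changes of argument and value, the Lovasz extension of the indicator function
  of \<U>. In this form continuity is visible without gluing over cones.\<close>

definition cut_function :: "'n set set \<Rightarrow> real^'n \<Rightarrow> real" where
  "cut_function \<U> x = Min ((\<lambda>U. Max ((\<lambda>i. x $ i) ` U)) ` \<U>)"

lemma continuous_on_Max_image:
  fixes f :: "'i \<Rightarrow> 'a::topological_space \<Rightarrow> real"
  assumes "finite I" "I \<noteq> {}" "\<And>i. i \<in> I \<Longrightarrow> continuous_on S (f i)"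
  shows "continuous_on S (\<lambda>x. Max ((\<lambda>i. f i x) ` I))"
  using assms by (induction rule: finite_ne_induct) (auto intro: continuous_on_max)

lemma continuous_on_Min_image:
  fixes f :: "'i \<Rightarrow> 'a::topological_space \<Rightarrow> real"
  assumes "finite I" "I \<noteq> {}" "\<And>i. i \<in> I \<Longrightarrow> continuous_on S (f i)"
  shows "continuous_on S (\<lambda>x. Min ((\<lambda>i. f i x) ` I))"
  using assms by (induction rule: finite_ne_induct) (auto intro: continuous_on_min)

lemma continuous_on_cut_function:
  fixes \<U> :: "'n::finite set set"
  assumes "proper_up_set \<U>"
  shows "continuous_on S (cut_function \<U>)"
proof -
  have "continuous_on S (\<lambda>x. Max ((\<lambda>i. x $ i) ` U))" if "U \<in> \<U>" for U
    using assms that by (intro continuous_on_Max_image) (auto simp: proper_up_set_def intro!: continuous_intros)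
  then have "continuous_on S (\<lambda>x. Min ((\<lambda>U. Max ((\<lambda>i. x $ i) ` U)) ` \<U>))"
    using assms by (intro continuous_on_Min_image) (auto simp: proper_up_set_def)
  then show ?thesis unfolding cut_function_def .
qed

text \<open>A minimax certificate: \<open>H\<close> bounds the minimum from above, and a large
  coordinate in each member of \<U> bounds it from below.\<close>

lemma cut_function_eqI:
  fixes \<U> :: "'n::finite set set"
  assumes "proper_up_set \<U>" "H \<in> \<U>" "\<And>i. i \<in> H \<Longrightarrow> x $ i \<le> c"
    and "\<And>U. U \<in> \<U> \<Longrightarrow> \<exists>i\<in>U. c \<le> x $ i"
  shows "cut_function \<U> x = c"
proof -
  let ?m = "\<lambda>U. Max ((\<lambda>i. x $ i) ` U)"
  have le: "c \<le> ?m U" if U: "U \<in> \<U>" for U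
  proof -
    obtain i where i: "i \<in> U" "c \<le> x $ i" using assms(4)[OF U] by blast
    then have "x $ i \<le> ?m U" by (intro Max_ge) auto
    with i(2) show ?thesis by (rule order_trans)
  qed
  have "H \<noteq> {}" using assms(1,2) by (auto simp: proper_up_set_def)
  then have "?m H \<le> c" using assms(3) by (intro Max.boundedI) auto
  then have "?m H = c" using le[OF assms(2)] by simp
  then have "c \<in> ?m ` \<U>" using assms(2) by (metis imageI)
  then show ?thesis unfolding cut_function_def using le by (intro Min_eqI) auto
qed

lemma cut_function_flat_vector:
  fixes \<U> :: "'n::finite set set"
  assumes \<U>: "proper_up_set \<U>"
  shows "cut_function \<U> (flat_vector F) = - of_bool (F \<in> \<U>)"
proof (cases "F \<in> \<U>")
  case True
  have "\<exists>i\<in>U. - 1 \<le> flat_vector F $ i" if U: "U \<in> \<U>" for U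
  proof -
    have "U \<noteq> {}" using \<U> U by (auto simp: proper_up_set_def)
    then show ?thesis by (auto simp: flat_vector_nth)
  qed
  then have "cut_function \<U> (flat_vector F) = - 1"
    using True by (intro cut_function_eqI[OF \<U>, of F]) (auto simp: flat_vector_nth)
  then show ?thesis using True by simp
next
  case False
  have "\<exists>i\<in>U. 0 \<le> flat_vector F $ i" if U: "U \<in> \<U>" for U
  proof -
    have "\<not> U \<subseteq> F" using \<U> U False by (auto simp: proper_up_set_def)
    then show ?thesis by (auto simp: flat_vector_nth)
  qed
  then have "cut_function \<U> (flat_vector F) = 0"
    using \<U> by (intro cut_function_eqI[OF \<U>, of UNIV]) (auto simp: flat_vector_nth proper_up_set_def)
  then show ?thesis using False by simp
qed

text \<open>\<open>p\<close> is the pivot of the smallest member \<open>?H\<close> of the flag that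
  lies in \<U>, where \<open>x $ p\<close> is the largest coordinate. If some \<open>U\<close> in
  \<U> had only smaller coordinates, a sublevel set containing \<open>U\<close> would be a member of
  both the flag and \<U>, hence contain \<open>?H\<close> and with it \<open>p\<close>.\<close>

lemma cut_function_coordinate:
  fixes \<U> \<F> :: "'n::finite set set"
  assumes \<U>: "proper_up_set \<U>" and flag: "flag \<F>"
  obtains p where "\<And>x. x \<in> chain_cone \<F> \<Longrightarrow> cut_function \<U> x = x $ p"
proof -
  let ?H = "\<Inter>(\<F> \<inter> \<U>)"
  have H: "?H \<in> \<F> \<inter> \<U>"
    using flag \<U> by (intro finite_chain_Inter_mem) (auto simp: flag_def chain_subset_def proper_up_set_def)
  then have "?H \<in> \<F>" by blast
  then obtain p where p: "\<And>G. G \<in> \<F> \<Longrightarrow> p \<in> G \<longleftrightarrow> ?H \<subseteq> G"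
    by (rule flag_pivot[OF flag]) blast
  have "cut_function \<U> x = x $ p" if x: "x \<in> chain_cone \<F>" for x
  proof (rule cut_function_eqI[OF \<U>, of ?H])
    show "?H \<in> \<U>" using H by blast
  next
    fix i assume i: "i \<in> ?H"
    have "\<forall>G\<in>\<F>. p \<in> G \<longrightarrow> i \<in> G" using p i by blast
    then show "x $ i \<le> x $ p" using x unfolding chain_cone_halfspaces[OF flag] by blast
  next
    fix U assume U: "U \<in> \<U>"
    show "\<exists>i\<in>U. x $ p \<le> x $ i"
    proof (rule ccontr)
      assume "\<not> ?thesis"
      then have less: "\<And>i. i \<in> U \<Longrightarrow> x $ i < x $ p" by force
      let ?t = "Max ((\<lambda>i. x $ i) ` U)"
      have "U \<noteq> {}" using U \<U> by (auto simp: proper_up_set_def)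
      then have t: "?t < x $ p" using less by (subst Max_less_iff) auto
      have "U \<subseteq> {i. x $ i \<le> ?t}" by (auto intro: Max_ge)
      then have "{i. x $ i \<le> ?t} \<in> \<U>" "{i. x $ i \<le> ?t} \<noteq> {}"
        using U \<U> \<open>U \<noteq> {}\<close> unfolding proper_up_set_def by blast+
      then have "{i. x $ i \<le> ?t} \<in> \<F> \<inter> \<U>" using sublevel_set_mem_flag[OF flag x] by blast
      then have "p \<in> {i. x $ i \<le> ?t}" using p[of "{i. x $ i \<le> ?t}"] by blast
      with t show False by simp
    qed
  qed
  then show ?thesis by (rule that)
qed

lemma integer_affine_on_coordinate:
  assumes "\<And>x. x \<in> \<sigma> \<Longrightarrow> \<phi> x = x $ p"
  shows "integer_affine_on \<sigma> \<phi> (axis p 1)"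
  using assms unfolding integer_affine_on_def
  by (auto simp: inner_axis' integer_vec_axis intro!: exI[of _ 0])

lemma flat_vector_empty: "flat_vector {} = (0 :: real^'n)"
  by (simp add: vec_eq_iff flat_vector_nth)

lemma linear_part_cut_function:
  fixes \<U> \<F> :: "'n::finite set set"
  assumes \<U>: "proper_up_set \<U>" and flag: "flag \<F>" and F: "F \<in> insert {} \<F>"
  shows "linear_part (cut_function \<U>) (chain_cone \<F>) (flat_vector F) = - of_bool (F \<in> \<U>)"
proof (cases "F = {}")
  case True
  then show ?thesis using \<U> by (simp add: flat_vector_empty linear_0[OF linear_linear_part] proper_up_set_def)
next
  case False
  then have F: "F \<in> \<F>" using F by simp
  obtain p where p: "\<And>x. x \<in> chain_cone \<F> \<Longrightarrow> cut_function \<U> x = x $ p"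
    by (rule cut_function_coordinate[OF \<U> flag]) blast
  have "linear_part (cut_function \<U>) (chain_cone \<F>) (flat_vector F) = axis p 1 \<bullet> flat_vector F"
    using F by (intro linear_part_eq integer_affine_on_coordinate p)
      (auto simp: direction_chain_cone[OF flag] intro: span_base)
  also have "\<dots> = cut_function \<U> (flat_vector F)"
    using p[OF flat_vector_mem_chain_cone[OF flag F]] by (simp add: inner_axis')
  finally show ?thesis by (simp add: cut_function_flat_vector[OF \<U>])
qed

text \<open>The linear parts on a ridge and on a facet are chosen independently; this reconciles
  them on the directions that they share.\<close>

lemma linear_part_mono:
  assumes "integer_affine_on \<sigma> \<phi> a" "\<tau> \<subseteq> \<sigma>" "v \<in> direction \<tau>"
  shows "linear_part \<phi> \<tau> v = linear_part \<phi> \<sigma> v"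
proof -
  have "integer_affine_on \<tau> \<phi> a" using assms(1,2) by (fastforce simp: integer_affine_on_def)
  moreover have "direction \<tau> \<subseteq> direction \<sigma>"
    unfolding direction_def using assms(2) by (intro span_mono) blast
  ultimately show ?thesis using assms linear_part_eq by (metis subsetD)
qed

section \<open>Complexes of flags\<close>

lemma
  fixes X :: "(real^'n::finite) weighted_complex"
  assumes cells: "cells X = chain_cone ` \<Phi>" and flags: "\<And>\<F>. \<F> \<in> \<Phi> \<Longrightarrow> flag \<F>"
  shows facets_flags: "facets X = chain_cone ` {\<F> \<in> \<Phi>. card \<F> = wdim X}"
    and ridges_flags: "ridges X = chain_cone ` {\<F> \<in> \<Phi>. Suc (card \<F>) = wdim X}"
    and facets_above_flags: "flag \<F> \<Longrightarrow>
      facets_above X (chain_cone \<F>) = chain_cone ` {\<G> \<in> \<Phi>. \<F> \<subset> \<G> \<and> card \<G> = wdim X}"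
proof -
  have dim: "aff_dim (chain_cone \<F>) = int (card \<F>)" if "\<F> \<in> \<Phi>" for \<F>
    by (rule aff_dim_chain_cone[OF flags[OF that]])
  show f: "facets X = chain_cone ` {\<F> \<in> \<Phi>. card \<F> = wdim X}"
    unfolding facets_def cells using dim by force
  have eq: "int (card \<F>) = int (wdim X) - 1 \<longleftrightarrow> Suc (card \<F>) = wdim X" for \<F> :: "'n set set"
    by linarith
  show "ridges X = chain_cone ` {\<F> \<in> \<Phi>. Suc (card \<F>) = wdim X}"
    unfolding ridges_def cells using dim eq by force
  assume "flag \<F>"
  then have "chain_cone \<F> \<subset> chain_cone \<G> \<longleftrightarrow> \<F> \<subset> \<G>" if "\<G> \<in> \<Phi>" for \<G>
    using flags[OF that] by (simp add: psubset_eq chain_cone_subset_iff chain_cone_eq_iff)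
  then show "facets_above X (chain_cone \<F>) = chain_cone ` {\<G> \<in> \<Phi>. \<F> \<subset> \<G> \<and> card \<G> = wdim X}"
    unfolding facets_above_def f by force
qed

text \<open>The matroid variety in terms of the rank function alone, so that the Higgs interpolants
  have one too.\<close>

definition flag_variety :: "('n set \<Rightarrow> nat) \<Rightarrow> (real^'n) weighted_complex" where
  "flag_variety r = \<lparr>wdim = r UNIV, cells = chain_cone ` flat_flags r, weight = (\<lambda>_. 1)\<rparr>"

lemma flag_variety_simps [simp]:
  "wdim (flag_variety r) = r UNIV" "cells (flag_variety r) = chain_cone ` flat_flags r"
  "weight (flag_variety r) \<sigma> = 1"
  by (simp_all add: flag_variety_def)

lemma cycle_eq_refl: "tropical_cycle X \<Longrightarrow> cycle_eq X X"
  unfolding cycle_eq_def refines_def by blast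

context loopfree_rank
begin

lemma
  shows facets_variety: "facets (flag_variety r) = chain_cone ` {\<F> \<in> flat_flags r. card \<F> = r UNIV}"
    and ridges_variety: "ridges (flag_variety r) = chain_cone ` {\<F> \<in> flat_flags r. Suc (card \<F>) = r UNIV}"
    and facets_above_variety: "flag \<F> \<Longrightarrow> facets_above (flag_variety r) (chain_cone \<F>)
      = chain_cone ` {\<G> \<in> flat_flags r. \<F> \<subset> \<G> \<and> card \<G> = r UNIV}"
  using facets_flags[of "flag_variety r" "flat_flags r"] ridges_flags[of "flag_variety r" "flat_flags r"]
    facets_above_flags[of "flag_variety r" "flat_flags r" \<F>] flat_flagsD(1) by simp_all

lemma UNIV_mem_flat_flag: "\<F> \<in> flat_flags r \<Longrightarrow> UNIV \<in> \<F>"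
  by (simp add: flat_flags_def flag_def)

lemma ridge_sum:
  fixes f :: "(real^'n) set \<Rightarrow> 'b::comm_monoid_add"
  assumes \<F>: "\<F> \<in> flat_flags r" and gap: "flag_gap \<F> A B"
  shows "(\<Sum>\<sigma>\<in>facets_above (flag_variety r) (chain_cone \<F>). f \<sigma>)
    = (\<Sum>G\<in>gap_flats A B. f (chain_cone (insert G \<F>)))"
proof -
  have ins: "insert G \<F> \<in> flat_flags r" "G \<notin> \<F>" if "G \<in> gap_flats A B" for G
    using gap that by (auto simp: flag_gap_def)
  have eq: "{\<G> \<in> flat_flags r. \<F> \<subset> \<G> \<and> card \<G> = r UNIV} = (\<lambda>G. insert G \<F>) ` gap_flats A B"
    using gap by (simp add: flag_gap_def)
  have "inj_on (\<lambda>G. chain_cone (insert G \<F>)) (gap_flats A B)"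
  proof (rule inj_onI)
    fix G H assume GH: "G \<in> gap_flats A B" "H \<in> gap_flats A B"
      and cones: "chain_cone (insert G \<F>) = chain_cone (insert H \<F>)"
    have "insert G \<F> = insert H \<F>"
      using chain_cone_eq_iff[OF ins(1)[OF GH(1), THEN flat_flagsD(1)] ins(1)[OF GH(2), THEN flat_flagsD(1)]]
        cones by blast
    then show "G = H" using ins(2)[OF GH(1)] ins(2)[OF GH(2)] by blast
  qed
  moreover have "facets_above (flag_variety r) (chain_cone \<F>)
      = (\<lambda>G. chain_cone (insert G \<F>)) ` gap_flats A B"
    unfolding facets_above_variety[OF flat_flagsD(1)[OF \<F>]] eq image_image ..
  ultimately show ?thesis by (simp add: sum.reindex)
qed

lemma normal_vector_gap:
  assumes "\<F> \<in> flat_flags r" "flag_gap \<F> A B" "G \<in> gap_flats A B"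
  shows "normal_vector (chain_cone (insert G \<F>)) (chain_cone \<F>) - flat_vector G
    \<in> span (flat_vector ` \<F>)"
proof (rule normal_vector_flag)
  have "insert G \<F> \<in> flat_flags r \<and> G \<notin> \<F>" using assms(2,3) by (simp add: flag_gap_def)
  then show "flag (insert G \<F>)" "G \<notin> \<F>" by (auto dest: flat_flagsD)
qed (rule UNIV_mem_flat_flag[OF assms(1)])

text \<open>Modulo the span of the ridge each normal vector is a flat vector, and the sum of those
  is a combination of the vectors of \<open>A\<close> and \<open>B\<close>. These lie in the span,
  the one of an empty \<open>A\<close> being 0.\<close>

lemma sum_gap_normals:
  assumes "\<F> \<in> flat_flags r" and gap: "flag_gap \<F> A B"
  shows "(\<Sum>G\<in>gap_flats A B. normal_vector (chain_cone (insert G \<F>)) (chain_cone \<F>))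
    \<in> span (flat_vector ` \<F>)"
proof -
  let ?n = "\<lambda>G. normal_vector (chain_cone (insert G \<F>)) (chain_cone \<F>)"
  have AB: "A \<in> insert {} \<F>" "B \<in> \<F>" "A \<subset> B" "r B = r A + 2" "A \<in> rank_flats r" "B \<in> rank_flats r"
    using gap by (simp_all add: flag_gap_def)
  have "(\<Sum>G\<in>gap_flats A B. ?n G - flat_vector G) \<in> span (flat_vector ` \<F>)"
    by (rule span_sum) (rule normal_vector_gap[OF assms])
  moreover have "flat_vector A \<in> span (flat_vector ` \<F>)"
    using AB(1) by (auto simp: flat_vector_empty span_zero intro: span_base)
  then have "(\<Sum>G\<in>gap_flats A B. flat_vector G) \<in> span (flat_vector ` \<F>)"
    unfolding sum_gap_flat_vectors[OF AB(5,6,3,4)]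
    using AB(2) by (intro span_add span_scale) (auto intro: span_base)
  ultimately have "(\<Sum>G\<in>gap_flats A B. ?n G - flat_vector G) + (\<Sum>G\<in>gap_flats A B. flat_vector G)
      \<in> span (flat_vector ` \<F>)" by (rule span_add)
  then show ?thesis by (simp add: sum_subtractf)
qed

lemma balanced_variety: "balanced (flag_variety r)"
  unfolding balanced_def ridges_variety
proof
  fix \<tau> assume "\<tau> \<in> chain_cone ` {\<F> \<in> flat_flags r. Suc (card \<F>) = r UNIV}"
  then obtain \<F> where \<F>: "\<F> \<in> flat_flags r" "Suc (card \<F>) = r UNIV" "\<tau> = chain_cone \<F>" by blast
  obtain A B where gap: "flag_gap \<F> A B" using ridge_has_gap[OF \<F>(1,2)] by blast
  show "weighted_normal_sum (flag_variety r) \<tau> \<in> direction \<tau>"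
    using sum_gap_normals[OF \<F>(1) gap] flat_flagsD(1)[OF \<F>(1)]
    by (simp add: weighted_normal_sum_def \<F>(3) ridge_sum[OF \<F>(1) gap] direction_chain_cone)
qed

lemma tropical_cycle_variety: "tropical_cycle (flag_variety r)"
  unfolding tropical_cycle_def
proof (intro conjI balanced_variety)
  show "polyhedral_complex (cells (flag_variety r))"
    using polyhedral_complex_chain_cones[of "flat_flags r"] flat_flagsD(1) flat_flags_subset by simp
  show "pure_complex (flag_variety r)"
    unfolding pure_complex_def
  proof
    fix \<tau> assume "\<tau> \<in> cells (flag_variety r)"
    then obtain \<F> where \<F>: "\<F> \<in> flat_flags r" "\<tau> = chain_cone \<F>" by auto
    obtain \<G> where "\<G> \<in> flat_flags r" "\<F> \<subseteq> \<G>" "card \<G> = r UNIV"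
      using flat_flag_extend_card[OF \<F>(1) card_flat_flag_le[OF \<F>(1)]] by blast
    then have "chain_cone \<G> \<in> facets (flag_variety r)" "\<tau> \<subseteq> chain_cone \<G>"
      using \<F>(2) chain_cone_mono[OF flat_flagsD(1)] by (auto simp: facets_variety)
    then show "\<exists>\<sigma>\<in>facets (flag_variety r). \<tau> \<subseteq> \<sigma>" by blast
  qed
qed

text \<open>The fine subdivision is itself adapted to the function, which is a coordinate on each of
  its cones.\<close>

lemma structure_for_cut_function:
  assumes "proper_up_set \<U>"
  shows "structure_for (cut_function \<U>) (flag_variety r) (flag_variety r)"
  unfolding structure_for_def
proof (intro conjI ballI)
  show "cycle_eq (flag_variety r) (flag_variety r)"
    by (rule cycle_eq_refl[OF tropical_cycle_variety])
  fix \<sigma> assume "\<sigma> \<in> cells (flag_variety r)"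
  then obtain \<F> where \<F>: "flag \<F>" "\<sigma> = chain_cone \<F>" using flat_flagsD(1) by auto
  obtain p where "\<And>x. x \<in> chain_cone \<F> \<Longrightarrow> cut_function \<U> x = x $ p"
    by (rule cut_function_coordinate[OF assms \<F>(1)]) blast
  then show "\<exists>a. integer_affine_on \<sigma> (cut_function \<U>) a"
    unfolding \<F>(2) using integer_affine_on_coordinate by blast
qed simp

lemma rational_cut_function:
  assumes "proper_up_set \<U>"
  shows "rational_function (flag_variety r) (cut_function \<U>)"
  using continuous_on_cut_function[OF assms] structure_for_cut_function[OF assms]
  unfolding rational_function_def by blast

end

section \<open>Elementary quotients\<close>

text \<open>A rank missing between \<open>A\<close> and \<open>B\<close> would leave room for one
  more flat. Applied to \<open>q\<close>, this detects ridges that are not full flags of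
  \<open>q\<close>.\<close>

lemma (in loopfree_rank) full_flag_step:
  assumes "\<F> \<in> flat_flags r" "card \<F> = r UNIV" "A \<in> rank_flats r" "B \<in> rank_flats r" "A \<subset> B"
    "\<And>F. F \<in> \<F> \<Longrightarrow> F \<subseteq> A \<or> B \<subseteq> F"
  shows "r B \<le> Suc (r A)"
proof (rule ccontr)
  assume "\<not> ?thesis"
  then have 2: "r A + 2 \<le> r B" by simp
  obtain x where x: "x \<in> B" "x \<notin> A" using assms(5) by blast
  note G = gap_flat[OF assms(3,4) 2 x psubset_imp_subset[OF assms(5)]]
  have "insert (rank_closure (insert x A)) \<F> \<in> flat_flags r" "rank_closure (insert x A) \<notin> \<F>"
    using insert_gap_flat_flag[OF assms(1) assms(6) G(1-3)] by blast+
  then show False using card_flat_flag_le[of "insert (rank_closure (insert x A)) \<F>"] assms(2) by simp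
qed

locale elementary_quotient = R: loopfree_rank r + Q: loopfree_rank q
  for r q :: "'n::finite set \<Rightarrow> nat" +
  fixes \<U> :: "'n set set"
  assumes up_set: "proper_up_set \<U>"
    and rank_drop: "r A = q A + of_bool (A \<in> \<U>)"
begin

lemma up_closed: "A \<in> \<U> \<Longrightarrow> A \<subseteq> B \<Longrightarrow> B \<in> \<U>"
  using up_set by (auto simp: proper_up_set_def)

lemma rank_UNIV: "r UNIV = Suc (q UNIV)"
  using rank_drop[of UNIV] up_set by (simp add: proper_up_set_def)

text \<open>A growing set can enter \<U> but never leave it, so a strict increase of
  \<open>q\<close> remains strict for \<open>r\<close>.\<close>

lemma quotient_flats: "rank_flats q \<subseteq> rank_flats r"
  unfolding rank_flats_def
proof (intro subsetI CollectI allI impI)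
  fix F x assume "F \<in> {F. \<forall>x. x \<notin> F \<longrightarrow> q F < q (insert x F)}" "x \<notin> F"
  then have "q F < q (insert x F)" by blast
  moreover have "F \<in> \<U> \<Longrightarrow> insert x F \<in> \<U>" using up_closed by blast
  ultimately show "r F < r (insert x F)" by (auto simp: rank_drop)
qed

lemma quotient_flat_flags: "flat_flags q \<subseteq> flat_flags r"
  using quotient_flats by (auto simp: flat_flags_def)

lemma gap_flat_rank:
  assumes "R.flag_gap \<F> A B" "G \<in> R.gap_flats A B"
  shows "r G = Suc (r A)"
proof -
  have "A \<in> rank_flats r" "G \<in> rank_flats r" "A \<subset> G" "G \<subset> B"
    using assms by (simp_all add: R.flag_gap_def R.gap_flats_def)
  then have "r A < r G" "r G < r B" using R.flat_rank_strict by blast+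
  then show ?thesis using assms(1) by (simp add: R.flag_gap_def)
qed

text \<open>For distinct \<open>G\<close> and \<open>H\<close> the values of \<open>q\<close> at
  \<open>G\<close>, \<open>H\<close> and \<open>A\<close> would all be \<open>r A\<close>, while
  \<open>q\<close> of the union is at least \<open>r A + 1\<close>. This contradicts submodularity
  of \<open>q\<close>.\<close>

lemma gap_flats_in_up_set_unique:
  assumes gap: "R.flag_gap \<F> A B" and "A \<notin> \<U>"
    and G: "G \<in> R.gap_flats A B" "G \<in> \<U>" and H: "H \<in> R.gap_flats A B" "H \<in> \<U>"
  shows "G = H"
proof (rule ccontr)
  assume "G \<noteq> H"
  have flats: "G \<in> rank_flats r" "H \<in> rank_flats r" "A \<subseteq> G \<inter> H"
    using G(1) H(1) by (auto simp: R.gap_flats_def)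
  have rGH: "r G = Suc (r A)" "r H = Suc (r A)" using gap_flat_rank[OF gap] G(1) H(1) by blast+
  have "G \<subset> G \<union> H \<or> H \<subset> G \<union> H" using \<open>G \<noteq> H\<close> by blast
  then have "Suc (r A) < r (G \<union> H)" using R.flat_rank_strict[of _ "G \<union> H"] flats rGH by metis
  moreover have "q (G \<union> H) + q (G \<inter> H) \<le> q G + q H" by (rule Q.submodular)
  moreover have "q A \<le> q (G \<inter> H)" by (rule Q.rank_mono[OF flats(3)])
  moreover have "G \<union> H \<in> \<U>" using up_closed[OF G(2)] by blast
  ultimately show False using rGH G(2) H(2) \<open>A \<notin> \<U>\<close> by (simp add: rank_drop)
qed

text \<open>A member \<open>F\<close> that is not a flat of \<open>q\<close> enters \<U> when some
  \<open>x\<close> is added. As \<open>B\<close> is in \<U>, \<open>F\<close> lies below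
  \<open>A\<close>, so \<open>insert x A\<close> is in \<U> as well. If \<open>x\<close> is in
  \<open>B\<close>, its closure is a flat of the gap in \<U>; otherwise submodularity of
  \<open>q\<close> fails for \<open>insert x A\<close> and \<open>B\<close>.\<close>

lemma ridge_is_quotient_flag:
  assumes \<F>: "\<F> \<in> flat_flags r" and gap: "R.flag_gap \<F> A B"
    and A: "A \<notin> \<U>" and B: "B \<in> \<U>" and none: "\<And>G. G \<in> R.gap_flats A B \<Longrightarrow> G \<notin> \<U>"
  shows "\<F> \<in> flat_flags q"
proof -
  have gap': "A \<subset> B" "r B = r A + 2" "A \<in> rank_flats r" "B \<in> rank_flats r" "\<forall>F\<in>\<F>. F \<subseteq> A \<or> B \<subseteq> F"
    using gap by (simp_all add: R.flag_gap_def)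
  have "q F < q (insert x F)" if F: "F \<in> \<F>" "x \<notin> F" for F x
  proof (rule ccontr)
    assume neg: "\<not> q F < q (insert x F)"
    have "F \<in> rank_flats r" using \<F> F(1) by (auto simp: flat_flags_def)
    then have less: "r F < r (insert x F)" using F(2) by (auto simp: rank_flats_def)
    then have ins: "insert x F \<in> \<U>" and "F \<notin> \<U>"
      using neg by (auto simp: rank_drop of_bool_def split: if_splits)
    then have FA: "F \<subseteq> A" using gap'(5) F(1) B up_closed by blast
    have xA: "x \<notin> A" using up_closed[OF ins, of A] FA A by blast
    have insA: "insert x A \<in> \<U>" by (rule up_closed[OF ins]) (use FA in blast)
    show False
    proof (cases "x \<in> B")
      case True
      have "R.rank_closure (insert x A) \<in> R.gap_flats A B"
        using R.gap_flats_unique[OF gap'(3,4,1,2) True xA] by blast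
      moreover have "R.rank_closure (insert x A) \<in> \<U>" using up_closed[OF insA R.closure_superset] .
      ultimately show False using none by blast
    next
      case False
      have "q (insert x A \<union> B) + q (insert x A \<inter> B) \<le> q (insert x A) + q B" by (rule Q.submodular)
      moreover have "insert x A \<union> B = insert x B" "insert x A \<inter> B = A" using gap'(1) False by blast+
      moreover have "r (insert x A) = Suc (r A)" "r (insert x B) = Suc (r B)"
        using R.cover_rank gap'(3,4) xA False by blast+
      moreover have "insert x B \<in> \<U>" using up_closed[OF B] by blast
      ultimately show False using A B insA by (simp add: rank_drop)
    qed
  qed
  then have "\<F> \<subseteq> rank_flats q" unfolding rank_flats_def by blast
  then show ?thesis using \<F> by (simp add: flat_flags_def)
qed

text \<open>The three cases are the positions of \<U> relative to the gap. By its size the ridge is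
  a full flag of \<open>q\<close> as soon as its members are flats of \<open>q\<close>, and then
  \<open>q\<close> rises by at most one across the gap.\<close>

lemma ridge_weight:
  assumes \<F>: "\<F> \<in> flat_flags r" "Suc (card \<F>) = r UNIV" and gap: "R.flag_gap \<F> A B"
  shows "of_bool (B \<in> \<U>) + (real (card (R.gap_flats A B)) - 1) * of_bool (A \<in> \<U>)
    - real (card {G \<in> R.gap_flats A B. G \<in> \<U>}) = of_bool (\<F> \<in> flat_flags q)"
proof -
  have gap': "A \<in> insert {} \<F>" "B \<in> \<F>" "A \<subset> B" "r B = r A + 2" "\<And>F. F \<in> \<F> \<Longrightarrow> F \<subseteq> A \<or> B \<subseteq> F"
    using gap by (simp_all add: R.flag_gap_def)
  have q_flats: "A \<in> rank_flats q" "B \<in> rank_flats q" if "\<F> \<in> flat_flags q"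
    using that gap'(1,2) Q.empty_flat by (auto simp: flat_flags_def)
  have step: "q B \<le> Suc (q A)" if "\<F> \<in> flat_flags q"
    using Q.full_flag_step[OF that _ q_flats[OF that] gap'(3,5)] \<F>(2) rank_UNIV by simp
  let ?S = "{G \<in> R.gap_flats A B. G \<in> \<U>}"
  consider "A \<in> \<U>" | "B \<notin> \<U>" | "A \<notin> \<U>" "B \<in> \<U>" by blast
  then show ?thesis
  proof cases
    case 1
    then have B: "B \<in> \<U>" using up_closed gap'(3) by blast
    have "?S = R.gap_flats A B" using up_closed[OF 1] by (auto simp: R.gap_flats_def)
    \<comment> \<open>Both ends of the gap lie in \<U>, so \<open>q\<close> rises by two across
      it.\<close>
    moreover have "\<F> \<notin> flat_flags q" using step gap'(4) 1 B by (auto simp: rank_drop)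
    ultimately show ?thesis using 1 B by simp
  next
    case 2
    then have A: "A \<notin> \<U>" using up_closed gap'(3) by blast
    have "G \<notin> \<U>" if "G \<in> R.gap_flats A B" for G
      using that 2 up_closed[of G B] by (auto simp: R.gap_flats_def)
    then have S: "?S = {}" by blast
    moreover have "\<F> \<notin> flat_flags q" using step gap'(4) 2 A by (auto simp: rank_drop)
    ultimately show ?thesis using 2 A unfolding S by simp
  next
    case 3
    show ?thesis
    proof (cases "?S = {}")
      case True
      then have "\<F> \<in> flat_flags q" using ridge_is_quotient_flag[OF \<F>(1) gap 3] by blast
      then show ?thesis using True 3 unfolding True by simp
    next
      case False
      then obtain G where G: "G \<in> R.gap_flats A B" "G \<in> \<U>" by blast
      then have S: "?S = {G}" using gap_flats_in_up_set_unique[OF gap 3(1)] by blast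
      \<comment> \<open>The rank gained from \<open>A\<close> to \<open>G\<close> is lost by
        entering \<U>, so \<open>A\<close> is not a flat of \<open>q\<close>.\<close>
      have "q G = q A" using gap_flat_rank[OF gap G(1)] G(2) 3(1) by (simp add: rank_drop)
      moreover have "A \<subset> G" using G(1) by (simp add: R.gap_flats_def)
      ultimately have "\<F> \<notin> flat_flags q" using q_flats(1) Q.flat_rank_strict[of A G] by auto
      then show ?thesis using 3 unfolding S by simp
    qed
  qed
qed

section \<open>The divisor as a weighted complex\<close>

definition divisor :: "(real^'n) weighted_complex" where
  "divisor = complex_divisor (cut_function \<U>) (flag_variety r)"

text \<open>All cells that \<open>complex_divisor\<close> retains, including those carrying weight
  0.\<close>

definition divisor_flags :: "'n set set set" where
  "divisor_flags = {\<F> \<in> flat_flags r. card \<F> < r UNIV}"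

lemma wdim_divisor: "wdim divisor = q UNIV"
  by (simp add: divisor_def complex_divisor_def rank_UNIV)

lemma cells_divisor: "cells divisor = chain_cone ` divisor_flags"
proof -
  have "aff_dim (chain_cone \<F>) = int (card \<F>)" if "\<F> \<in> flat_flags r" for \<F>
    using aff_dim_chain_cone R.flat_flagsD(1)[OF that] by blast
  then show ?thesis
    by (force simp: divisor_def complex_divisor_def divisor_flags_def)
qed

text \<open>Each normal vector is \<open>flat_vector G\<close> plus a vector in the span of the
  ridge. These corrections contribute equally to the sum over facets and to the term of the ridge,
  so only the count of \<open>ridge_weight\<close> survives.\<close>

lemma weight_divisor:
  assumes \<F>: "\<F> \<in> flat_flags r" and card: "card \<F> = q UNIV"
  shows "weight divisor (chain_cone \<F>) = of_bool (\<F> \<in> flat_flags q)"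
proof -
  have card': "Suc (card \<F>) = r UNIV" using card rank_UNIV by simp
  obtain A B where gap: "R.flag_gap \<F> A B" using R.ridge_has_gap[OF \<F> card'] by blast
  have gap': "A \<in> insert {} \<F>" "B \<in> insert {} \<F>" "A \<subset> B" "r B = r A + 2"
      "A \<in> rank_flats r" "B \<in> rank_flats r"
    and ins: "\<And>G. G \<in> R.gap_flats A B \<Longrightarrow> insert G \<F> \<in> flat_flags r"
    using gap by (simp_all add: R.flag_gap_def)
  let ?\<phi> = "cut_function \<U>" and ?\<tau> = "chain_cone \<F>" and ?S = "R.gap_flats A B"
  let ?\<sigma> = "\<lambda>G. chain_cone (insert G \<F>)" and ?n = "\<lambda>G. normal_vector (chain_cone (insert G \<F>)) (chain_cone \<F>)"
  let ?l = "linear_part ?\<phi> ?\<tau>"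
  have flag: "flag \<F>" by (rule R.flat_flagsD(1)[OF \<F>])
  have l: "linear_part ?\<phi> (?\<sigma> G) (?n G) = - of_bool (G \<in> \<U>) + ?l (?n G - flat_vector G)"
    if G: "G \<in> ?S" for G
  proof -
    have flag': "flag (insert G \<F>)" by (rule R.flat_flagsD(1)[OF ins[OF G]])
    obtain p where p: "\<And>x. x \<in> ?\<sigma> G \<Longrightarrow> ?\<phi> x = x $ p"
      by (rule cut_function_coordinate[OF up_set flag']) blast
    have "?l (?n G - flat_vector G) = linear_part ?\<phi> (?\<sigma> G) (?n G - flat_vector G)"
    proof (rule linear_part_mono)
      show "integer_affine_on (?\<sigma> G) ?\<phi> (axis p 1)" by (rule integer_affine_on_coordinate[OF p])
      show "?\<tau> \<subseteq> ?\<sigma> G" by (rule chain_cone_mono[OF flag']) blast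
      show "?n G - flat_vector G \<in> direction ?\<tau>"
        using R.normal_vector_gap[OF \<F> gap G] by (simp add: direction_chain_cone[OF flag])
    qed
    moreover have "linear_part ?\<phi> (?\<sigma> G) (flat_vector G) = - of_bool (G \<in> \<U>)"
      by (rule linear_part_cut_function[OF up_set flag']) simp
    ultimately show ?thesis by (simp add: linear_diff[OF linear_linear_part])
  qed
  have "(\<Sum>\<sigma>\<in>facets_above (flag_variety r) ?\<tau>.
        linear_part ?\<phi> \<sigma> (of_int (weight (flag_variety r) \<sigma>) *\<^sub>R normal_vector \<sigma> ?\<tau>))
      = (\<Sum>G\<in>?S. linear_part ?\<phi> (?\<sigma> G) (?n G))"
    by (simp add: R.ridge_sum[OF \<F> gap])
  also have "\<dots> = (\<Sum>G\<in>?S. - of_bool (G \<in> \<U>) + ?l (?n G - flat_vector G))"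
    using l by (intro sum.cong) auto
  also have "\<dots> = (\<Sum>G\<in>?S. - of_bool (G \<in> \<U>)) + (\<Sum>G\<in>?S. ?l (?n G - flat_vector G))"
    by (rule sum.distrib)
  also have "\<dots> = - real (card {G \<in> ?S. G \<in> \<U>}) + ?l (\<Sum>G\<in>?S. ?n G - flat_vector G)"
    by (simp add: linear_sum[OF linear_linear_part] sum_negf of_bool_def sum.If_cases Int_def)
  finally have 1: "(\<Sum>\<sigma>\<in>facets_above (flag_variety r) ?\<tau>.
        linear_part ?\<phi> \<sigma> (of_int (weight (flag_variety r) \<sigma>) *\<^sub>R normal_vector \<sigma> ?\<tau>))
      = - real (card {G \<in> ?S. G \<in> \<U>}) + ?l (\<Sum>G\<in>?S. ?n G - flat_vector G)" .
  have "weighted_normal_sum (flag_variety r) ?\<tau>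
      = (\<Sum>G\<in>?S. ?n G - flat_vector G) + (\<Sum>G\<in>?S. flat_vector G)"
    by (simp add: weighted_normal_sum_def R.ridge_sum[OF \<F> gap] sum_subtractf)
  then have "?l (weighted_normal_sum (flag_variety r) ?\<tau>) = ?l (\<Sum>G\<in>?S. ?n G - flat_vector G)
      + ?l (flat_vector B) + (real (card ?S) - 1) * ?l (flat_vector A)"
    using R.sum_gap_flat_vectors[OF gap'(5,6,3,4)]
    by (simp add: linear_add[OF linear_linear_part] linear_scale[OF linear_linear_part])
  then have 2: "?l (weighted_normal_sum (flag_variety r) ?\<tau>) = ?l (\<Sum>G\<in>?S. ?n G - flat_vector G)
      - of_bool (B \<in> \<U>) - (real (card ?S) - 1) * of_bool (A \<in> \<U>)"
    by (simp add: linear_part_cut_function[OF up_set flag gap'(1)]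
        linear_part_cut_function[OF up_set flag gap'(2)])
  \<comment> \<open>The real number under the floor is 0 or 1, so rounding loses nothing.\<close>
  have "weight divisor ?\<tau> = \<lfloor>of_bool (\<F> \<in> flat_flags q) :: real\<rfloor>"
    unfolding divisor_def complex_divisor_def weighted_complex.simps 1 2
      ridge_weight[OF \<F> card' gap, symmetric] by (simp add: algebra_simps)
  then show ?thesis by simp
qed

lemma divisor_flagsD: "\<F> \<in> divisor_flags \<Longrightarrow> flag \<F>"
  by (simp add: divisor_flags_def R.flat_flagsD(1))

lemma quotient_flags_divisor: "\<F> \<in> flat_flags q \<Longrightarrow> \<F> \<in> divisor_flags"
  unfolding divisor_flags_def mem_Collect_eq
  using quotient_flat_flags le_imp_less_Suc[OF Q.card_flat_flag_le] rank_UNIV by auto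

lemma facets_divisor: "facets divisor = chain_cone ` {\<F> \<in> divisor_flags. card \<F> = q UNIV}"
  by (simp add: facets_flags[OF cells_divisor divisor_flagsD] wdim_divisor)

lemma weight_divisor_flag:
  assumes "\<F> \<in> divisor_flags" "card \<F> = q UNIV"
  shows "weight divisor (chain_cone \<F>) = of_bool (\<F> \<in> flat_flags q)"
  using assms by (intro weight_divisor) (simp_all add: divisor_flags_def)

lemma support_divisor: "support divisor = support (flag_variety q)"
proof -
  have "{\<sigma> \<in> facets divisor. weight divisor \<sigma> \<noteq> 0} = chain_cone ` {\<F> \<in> flat_flags q. card \<F> = q UNIV}"
    unfolding facets_divisor using weight_divisor_flag quotient_flags_divisor by force
  then show ?thesis by (simp add: support_def Q.facets_variety)
qed

text \<open>Facets outside \<open>flat_flags q\<close> have weight 0, and a flag outside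
  \<open>flat_flags q\<close> lies in no flag of flats of \<open>q\<close>. Balancing of the divisor
  thus reduces to that of the variety of \<open>q\<close>.\<close>

lemma weighted_normal_sum_divisor:
  assumes "\<F> \<in> divisor_flags"
  shows "weighted_normal_sum divisor (chain_cone \<F>)
    = (if \<F> \<in> flat_flags q then weighted_normal_sum (flag_variety q) (chain_cone \<F>) else 0)"
proof -
  let ?\<tau> = "chain_cone \<F>" and ?n = "\<lambda>\<sigma>. normal_vector \<sigma> (chain_cone \<F>)"
  let ?S = "{\<G> \<in> flat_flags q. \<F> \<subset> \<G> \<and> card \<G> = q UNIV}"
  have flag: "flag \<F>" using assms by (rule divisor_flagsD)
  have above: "facets_above divisor ?\<tau> = chain_cone ` {\<G> \<in> divisor_flags. \<F> \<subset> \<G> \<and> card \<G> = q UNIV}"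
    using facets_above_flags[OF cells_divisor divisor_flagsD flag] by (simp add: wdim_divisor)
  have "weighted_normal_sum divisor ?\<tau> = (\<Sum>\<sigma>\<in>chain_cone ` ?S. ?n \<sigma>)"
    unfolding weighted_normal_sum_def above
  proof (rule sum.mono_neutral_cong_right)
    show "chain_cone ` ?S \<subseteq> chain_cone ` {\<G> \<in> divisor_flags. \<F> \<subset> \<G> \<and> card \<G> = q UNIV}"
      using quotient_flags_divisor by blast
  next
    show "\<forall>\<sigma>\<in>chain_cone ` {\<G> \<in> divisor_flags. \<F> \<subset> \<G> \<and> card \<G> = q UNIV} - chain_cone ` ?S.
        of_int (weight divisor \<sigma>) *\<^sub>R ?n \<sigma> = 0"
      using weight_divisor_flag by auto
  next
    fix \<sigma> assume "\<sigma> \<in> chain_cone ` ?S"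
    then show "of_int (weight divisor \<sigma>) *\<^sub>R ?n \<sigma> = ?n \<sigma>"
      using weight_divisor_flag quotient_flags_divisor by auto
  qed simp
  also have "\<dots> = (if \<F> \<in> flat_flags q then weighted_normal_sum (flag_variety q) ?\<tau> else 0)"
  proof (cases "\<F> \<in> flat_flags q")
    case True
    then show ?thesis by (simp add: weighted_normal_sum_def Q.facets_above_variety[OF flag])
  next
    case False
    then have "?S = {}" using Q.flat_flags_subset[of _ \<F>] flag by (auto simp: flag_def)
    then show ?thesis using False by (simp only: image_empty sum.empty if_False)
  qed
  finally show ?thesis .
qed

lemma tropical_cycle_divisor: "tropical_cycle divisor"
  unfolding tropical_cycle_def
proof (intro conjI)
  show "polyhedral_complex (cells divisor)"
    unfolding cells_divisor
  proof (rule polyhedral_complex_chain_cones[OF divisor_flagsD])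
    fix \<F> \<G> assume "\<F> \<in> divisor_flags" "\<G> \<subseteq> \<F>" "UNIV \<in> \<G>"
    moreover from this have "card \<G> \<le> card \<F>" by (intro card_mono) auto
    ultimately show "\<G> \<in> divisor_flags"
      using R.flat_flags_subset[of \<F> \<G>] by (simp add: divisor_flags_def)
  qed
  show "pure_complex divisor"
    unfolding pure_complex_def cells_divisor
  proof
    fix \<tau> assume "\<tau> \<in> chain_cone ` divisor_flags"
    then obtain \<F> where \<F>: "\<F> \<in> flat_flags r" "card \<F> < r UNIV" "\<tau> = chain_cone \<F>"
      by (auto simp: divisor_flags_def)
    \<comment> \<open>The extension uses flats of \<open>r\<close>: purity counts facets of weight 0
      as well.\<close>
    have "card \<F> \<le> q UNIV" "q UNIV \<le> r UNIV" using \<F>(2) rank_UNIV by simp_all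
    from R.flat_flag_extend_card[OF \<F>(1) this]
    obtain \<G> where \<G>: "\<G> \<in> flat_flags r" "\<F> \<subseteq> \<G>" "card \<G> = q UNIV" by blast
    then have "chain_cone \<G> \<in> facets divisor" "\<tau> \<subseteq> chain_cone \<G>"
      using \<F>(3) chain_cone_mono[OF R.flat_flagsD(1)] rank_UNIV
      by (auto simp: facets_divisor divisor_flags_def)
    then show "\<exists>\<sigma>\<in>facets divisor. \<tau> \<subseteq> \<sigma>" by blast
  qed
  show "balanced divisor"
    unfolding balanced_def
  proof
    fix \<tau> assume "\<tau> \<in> ridges divisor"
    then obtain \<F> where \<F>: "\<F> \<in> divisor_flags" "Suc (card \<F>) = q UNIV" "\<tau> = chain_cone \<F>"
      using ridges_flags[OF cells_divisor divisor_flagsD] by (auto simp: wdim_divisor)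
    have "weighted_normal_sum (flag_variety q) \<tau> \<in> direction \<tau>" if "\<F> \<in> flat_flags q"
      using Q.balanced_variety that \<F>(2,3) by (auto simp: balanced_def Q.ridges_variety)
    then show "weighted_normal_sum divisor \<tau> \<in> direction \<tau>"
      using weighted_normal_sum_divisor[OF \<F>(1)] by (auto simp: \<F>(3) direction_def span_zero)
  qed
qed

text \<open>The variety of \<open>q\<close> serves as the common refinement: its facets are exactly
  the facets of nonzero weight of the divisor.\<close>

lemma is_divisor_cut_function: "is_divisor (cut_function \<U>) (flag_variety r) (flag_variety q)"
proof -
  have "refines (flag_variety q) divisor"
    unfolding refines_def
  proof (intro conjI ballI impI)
    fix \<sigma> assume "\<sigma> \<in> facets (flag_variety q)"
    then obtain \<F> where \<F>: "\<F> \<in> flat_flags q" "card \<F> = q UNIV" "\<sigma> = chain_cone \<F>"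
      unfolding Q.facets_variety by blast
    then have "\<sigma> \<in> facets divisor" "weight divisor \<sigma> = 1"
      using quotient_flags_divisor[OF \<F>(1)] weight_divisor_flag[of \<F>] by (simp_all add: facets_divisor)
    then show "\<exists>\<sigma>'\<in>facets divisor. \<sigma> \<subseteq> \<sigma>' \<and> weight (flag_variety q) \<sigma> = weight divisor \<sigma>'" by auto
  qed (simp_all add: wdim_divisor support_divisor)
  moreover have "refines (flag_variety q) (flag_variety q)" unfolding refines_def by blast
  ultimately have "cycle_eq divisor (flag_variety q)"
    unfolding cycle_eq_def using tropical_cycle_divisor Q.tropical_cycle_variety by blast
  then show ?thesis
    unfolding is_divisor_def divisor_def
    using R.rational_cut_function[OF up_set] R.structure_for_cut_function[OF up_set] by blast
qed

end

section \<open>Quotients\<close>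

locale rank_quotient = R: loopfree_rank r + Q: loopfree_rank q
  for r q :: "'n::finite set \<Rightarrow> nat" +
  assumes flats_subset: "rank_flats q \<subseteq> rank_flats r"
begin

text \<open>One element at a time. Closures for \<open>q\<close> are flats of \<open>r\<close>,
  hence contain the closures for \<open>r\<close>: if \<open>r\<close> does not grow, neither does
  \<open>q\<close>. If \<open>r\<close> grows, \<open>q\<close> grows by at most one. The additive
  form avoids truncated subtraction.\<close>

lemma rank_difference_mono:
  assumes "A \<subseteq> B"
  shows "r A + q B \<le> r B + q A"
proof -
  have "r A + q (A \<union> C) \<le> r (A \<union> C) + q A" if "finite C" for C
    using that
  proof (induction C)
    case (insert x C)
    let ?D = "A \<union> C"
    have "r ?D + q (insert x ?D) \<le> r (insert x ?D) + q ?D"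
    proof (cases "x \<in> R.rank_closure ?D")
      case True
      have "R.rank_closure ?D \<subseteq> Q.rank_closure ?D"
        using Q.closure_flat flats_subset Q.closure_superset by (intro R.closure_subset_flat) blast+
      with True show ?thesis by (auto simp: Q.rank_closure_def R.rank_closure_def)
    next
      case False
      then have "r ?D < r (insert x ?D)"
        using R.rank_insert_mono[of ?D x] by (auto simp: R.rank_closure_def)
      then show ?thesis using Q.rank_insert_le[of x ?D] by simp
    qed
    then show ?case using insert.IH by simp
  qed simp
  from this[of B] show ?thesis using assms by (simp add: sup.absorb2)
qed

lemma quotient_rank_le: "q A \<le> r A"
  using rank_difference_mono[of "{}" A] by (simp add: R.rank_empty Q.rank_empty)

definition higgs_rank :: "nat \<Rightarrow> 'n set \<Rightarrow> nat" where
  "higgs_rank i A = min (q A + i) (r A)"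

definition higgs_up_set :: "nat \<Rightarrow> 'n set set" where
  "higgs_up_set i = {A. q A + i \<le> r A}"

lemma loopfree_rank_higgs: "loopfree_rank (higgs_rank i)"
proof
  show "higgs_rank i {} = 0" by (simp add: higgs_rank_def R.rank_empty)
  show "higgs_rank i {x} = 1" for x by (simp add: higgs_rank_def R.rank_singleton Q.rank_singleton)
  show "higgs_rank i A \<le> higgs_rank i (insert x A)" for x A
    unfolding higgs_rank_def using R.rank_insert_mono Q.rank_insert_mono
    by (intro min.mono add_right_mono)
  fix A B
  \<comment> \<open>When the minima at \<open>A\<close> and \<open>B\<close> are, say,
    \<open>q A + i\<close> and \<open>r B\<close>, the union is bounded by its \<open>q\<close> term
    and the intersection by its \<open>r\<close> term; submodularity of \<open>q\<close> and the
    growth of the difference from \<open>A \<inter> B\<close> to \<open>B\<close> finish this case.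
    If both minima are of one kind, submodularity of \<open>q\<close> or of \<open>r\<close> is
    enough.\<close>
  have "r A + q (A \<union> B) \<le> r (A \<union> B) + q A" "r B + q (A \<union> B) \<le> r (A \<union> B) + q B"
    "r (A \<inter> B) + q A \<le> r A + q (A \<inter> B)" "r (A \<inter> B) + q B \<le> r B + q (A \<inter> B)"
    by (intro rank_difference_mono; blast)+
  then show "higgs_rank i (A \<union> B) + higgs_rank i (A \<inter> B) \<le> higgs_rank i A + higgs_rank i B"
    using R.submodular[of A B] Q.submodular[of A B] unfolding higgs_rank_def min_def by simp
qed

text \<open>\<open>0 < i\<close> keeps the empty set out, and \<open>i\<close> not exceeding the
  difference of the total ranks lets \<open>UNIV\<close> in.\<close>

lemma proper_higgs_up_set:
  assumes "0 < i" "q UNIV + i \<le> r UNIV"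
  shows "proper_up_set (higgs_up_set i)"
proof -
  have "B \<in> higgs_up_set i" if "A \<in> higgs_up_set i" "A \<subseteq> B" for A B
    using rank_difference_mono[OF that(2)] that(1) by (simp add: higgs_up_set_def)
  then show ?thesis
    using assms by (auto simp: proper_up_set_def higgs_up_set_def R.rank_empty)
qed

lemma elementary_quotient_higgs:
  assumes "q UNIV + Suc i \<le> r UNIV"
  shows "elementary_quotient (higgs_rank (Suc i)) (higgs_rank i) (higgs_up_set (Suc i))"
proof (intro elementary_quotient.intro elementary_quotient_axioms.intro loopfree_rank_higgs)
  show "proper_up_set (higgs_up_set (Suc i))" using assms by (intro proper_higgs_up_set) simp_all
  show "higgs_rank (Suc i) A = higgs_rank i A + of_bool (A \<in> higgs_up_set (Suc i))" for A
    by (simp add: higgs_rank_def higgs_up_set_def)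
qed

text \<open>The head of the list acts last, so the induction descends from \<open>i = k\<close>.
  There the Higgs rank is \<open>r\<close>, because the rank difference is largest on
  \<open>UNIV\<close>, where it is \<open>k\<close>.\<close>

lemma is_product_higgs:
  assumes k: "r UNIV = q UNIV + k" and "i \<le> k"
  shows "is_product (map (\<lambda>j. cut_function (higgs_up_set j)) [Suc i..<Suc k])
    (flag_variety r) (flag_variety (higgs_rank i))"
  using assms(2)
proof (induction rule: inc_induct)
  case base
  have "higgs_rank k = r"
  proof
    fix A
    show "higgs_rank k A = r A" using rank_difference_mono[of A UNIV] k by (simp add: higgs_rank_def)
  qed
  then show ?case using cycle_eq_refl[OF R.tropical_cycle_variety] by simp
next
  case (step i)
  then have "q UNIV + Suc i \<le> r UNIV" using k by simp
  then have "is_divisor (cut_function (higgs_up_set (Suc i))) (flag_variety (higgs_rank (Suc i)))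
      (flag_variety (higgs_rank i))"
    using elementary_quotient.is_divisor_cut_function[OF elementary_quotient_higgs] by blast
  moreover have "[Suc i..<Suc k] = Suc i # [Suc (Suc i)..<Suc k]"
    using step.hyps by (simp add: upt_conv_Cons del: upt_Suc)
  ultimately show ?case using step.IH by (auto simp del: upt_Suc)
qed

lemma quotient_variety_is_product:
  assumes "r UNIV = q UNIV + k"
  shows "\<exists>\<phi>s. length \<phi>s = k \<and> (\<forall>\<phi>\<in>set \<phi>s. rational_function (flag_variety r) \<phi>) \<and>
    is_product \<phi>s (flag_variety r) (flag_variety q)"
proof (intro exI conjI ballI)
  let ?\<phi>s = "map (\<lambda>j. cut_function (higgs_up_set j)) [Suc 0..<Suc k]"
  show "length ?\<phi>s = k" by simp
  have "higgs_rank 0 = q"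
    by (rule ext) (simp add: higgs_rank_def quotient_rank_le)
  then show "is_product ?\<phi>s (flag_variety r) (flag_variety q)"
    using is_product_higgs[OF assms, of 0] by simp
  \<comment> \<open>Rationality is claimed on the initial variety, although the function is applied
    to a later cycle. Each cut function is rational on the variety of every rank function.\<close>
  fix \<phi> assume "\<phi> \<in> set ?\<phi>s"
  then obtain j where j: "\<phi> = cut_function (higgs_up_set j)" "0 < j" "j \<le> k" by auto
  then have "proper_up_set (higgs_up_set j)" using assms by (intro proper_higgs_up_set) simp_all
  then show "rational_function (flag_variety r) \<phi>" unfolding j(1) by (rule R.rational_cut_function)
qed

end

section \<open>Matroids\<close>

lemma
  fixes M :: "'n::finite set set"
  assumes "matroid UNIV M"
  shows card_le_matroid_rank: "B \<in> M \<Longrightarrow> B \<subseteq> A \<Longrightarrow> card B \<le> matroid_rank M A"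
    and matroid_basis: "\<exists>B\<in>M. B \<subseteq> A \<and> card B = matroid_rank M A"
proof -
  show "B \<in> M \<Longrightarrow> B \<subseteq> A \<Longrightarrow> card B \<le> matroid_rank M A"
    unfolding matroid_rank_def by (intro Max_ge) auto
  have "{} \<in> M" using assms by (simp add: matroid_def)
  then have "matroid_rank M A \<in> card ` {B \<in> M. B \<subseteq> A}"
    unfolding matroid_rank_def by (intro Max_in) auto
  then show "\<exists>B\<in>M. B \<subseteq> A \<and> card B = matroid_rank M A" by auto
qed

text \<open>A largest independent set between \<open>I\<close> and \<open>A\<close> is a basis of
  \<open>A\<close>, as exchange would enlarge a smaller one.\<close>

lemma matroid_basis_extend:
  fixes M :: "'n::finite set set"
  assumes M: "matroid UNIV M" and I: "I \<in> M" "I \<subseteq> A"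
  shows "\<exists>K\<in>M. I \<subseteq> K \<and> K \<subseteq> A \<and> card K = matroid_rank M A"
proof -
  have "\<forall>K. K \<in> M \<and> I \<subseteq> K \<and> K \<subseteq> A \<longrightarrow> card K < Suc (matroid_rank M A)"
    using card_le_matroid_rank[OF M] le_imp_less_Suc by blast
  moreover have "I \<in> M \<and> I \<subseteq> I \<and> I \<subseteq> A" using I by simp
  ultimately have "\<exists>K. (K \<in> M \<and> I \<subseteq> K \<and> K \<subseteq> A) \<and>
      (\<forall>L. L \<in> M \<and> I \<subseteq> L \<and> L \<subseteq> A \<longrightarrow> card L \<le> card K)"
    by (intro ex_has_greatest_nat[of "\<lambda>K. K \<in> M \<and> I \<subseteq> K \<and> K \<subseteq> A" I card])
  then obtain K where K: "K \<in> M" "I \<subseteq> K" "K \<subseteq> A"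
    and max: "\<And>L. L \<in> M \<Longrightarrow> I \<subseteq> L \<Longrightarrow> L \<subseteq> A \<Longrightarrow> card L \<le> card K" by blast
  have "\<not> card K < matroid_rank M A"
  proof
    assume less: "card K < matroid_rank M A"
    obtain B where B: "B \<in> M" "B \<subseteq> A" "card B = matroid_rank M A" using matroid_basis[OF M] by blast
    then obtain x where x: "x \<in> B - K" "insert x K \<in> M"
      using M K(1) less unfolding matroid_def by metis
    then have "card (insert x K) \<le> card K" using K B(2) by (intro max) auto
    then show False using x(1) by simp
  qed
  then have "card K = matroid_rank M A" using card_le_matroid_rank[OF M K(1,3)] by simp
  then show ?thesis using K by blast
qed

text \<open>For submodularity a basis of the intersection is extended to a basis \<open>K\<close> of
  the union; its traces on \<open>A\<close> and \<open>B\<close> are independent and cover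
  \<open>K\<close>, and they overlap at least in the smaller basis.\<close>

lemma loopfree_rank_matroid:
  fixes M :: "'n::finite set set"
  assumes M: "matroid UNIV M" and "loopfree UNIV M"
  shows "loopfree_rank (matroid_rank M)"
proof
  have sub: "C \<in> M" if "B \<in> M" "C \<subseteq> B" for B C using M that unfolding matroid_def by blast
  show "matroid_rank M {x} = 1" for x using assms(2) by (simp add: loopfree_def)
  show "matroid_rank M {} = 0" using matroid_basis[OF M, of "{}"] by auto
  show "matroid_rank M A \<le> matroid_rank M (insert x A)" for x A
    using matroid_basis[OF M, of A] card_le_matroid_rank[OF M, of _ "insert x A"] by (metis subset_insertI2)
  fix A B
  obtain I where I: "I \<in> M" "I \<subseteq> A \<inter> B" "card I = matroid_rank M (A \<inter> B)"
    using matroid_basis[OF M] by blast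
  then have "I \<subseteq> A \<union> B" by blast
  then obtain K where K: "K \<in> M" "I \<subseteq> K" "K \<subseteq> A \<union> B" "card K = matroid_rank M (A \<union> B)"
    using matroid_basis_extend[OF M I(1)] by blast
  have "card K + card I \<le> card ((K \<inter> A) \<union> (K \<inter> B)) + card ((K \<inter> A) \<inter> (K \<inter> B))"
    using K(2,3) I(2) by (intro add_mono card_mono) auto
  also have "\<dots> = card (K \<inter> A) + card (K \<inter> B)" by (rule card_Un_Int[symmetric]) simp_all
  also have "\<dots> \<le> matroid_rank M A + matroid_rank M B"
    using sub[OF K(1)] by (intro add_mono card_le_matroid_rank[OF M]) auto
  finally show "matroid_rank M (A \<union> B) + matroid_rank M (A \<inter> B) \<le> matroid_rank M A + matroid_rank M B"
    using K(4) I(3) by simp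
qed

lemma matroid_variety_eq_flag_variety: "matroid_variety M = flag_variety (matroid_rank M)"
proof -
  have "flats UNIV M = rank_flats (matroid_rank M)" by (auto simp: flats_def rank_flats_def)
  then have "flat_chains M = flat_flags (matroid_rank M)"
    by (auto simp: flat_chains_def flat_flags_def flag_def)
  then show ?thesis by (simp add: matroid_variety_def flag_variety_def)
qed

text \<open>The vector of a nonempty flat \<open>F\<close> of \<open>q\<close> lies on a facet,
  hence in the cone of some flag of flats of \<open>r\<close>, and such a flag must have
  \<open>F\<close> as a member.\<close>

lemma flats_subset_if_support_subset:
  fixes r q :: "'n::finite set \<Rightarrow> nat"
  assumes "loopfree_rank r" "loopfree_rank q"
    and supp: "support (flag_variety q) \<subseteq> support (flag_variety r)"
  shows "rank_flats q \<subseteq> rank_flats r"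
proof
  interpret R: loopfree_rank r by fact
  interpret Q: loopfree_rank q by fact
  fix F assume F: "F \<in> rank_flats q"
  show "F \<in> rank_flats r"
  proof (cases "F = {}")
    case True
    then show ?thesis using R.empty_flat by simp
  next
    case False
    then have flag: "{F, UNIV} \<in> flat_flags q"
      using F Q.UNIV_flat by (auto simp: flat_flags_def flag_def chain_subset_def)
    obtain \<G> where \<G>: "\<G> \<in> flat_flags q" "{F, UNIV} \<subseteq> \<G>" "card \<G> = q UNIV"
      using Q.flat_flag_extend_card[OF flag Q.card_flat_flag_le[OF flag]] by blast
    then have "flat_vector F \<in> chain_cone \<G>"
      using flat_vector_mem_chain_cone[OF Q.flat_flagsD(1)] by blast
    then have "flat_vector F \<in> support (flag_variety q)"
      using \<G> by (auto simp: support_def Q.facets_variety)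
    then obtain \<F> where \<F>: "\<F> \<in> flat_flags r" "flat_vector F \<in> chain_cone \<F>"
      using supp by (auto simp: support_def R.facets_variety)
    then have "F \<in> \<F>" using flat_vector_mem_chain_coneD[OF R.flat_flagsD(1)] False by blast
    then show ?thesis by (rule R.flat_flagsD(2)[OF \<F>(1)])
  qed
qed

theorem corollary3p11:
  fixes M N :: "'n::finite set set" and k :: nat
  assumes "matroid UNIV M" and "loopfree UNIV M"
    and "matroid UNIV N" and "loopfree UNIV N"
    and "subcycle (matroid_variety N) (matroid_variety M)"
    and "wdim (matroid_variety N) + k = wdim (matroid_variety M)"
  shows "\<exists>\<phi>s. length \<phi>s = k \<and>
           (\<forall>\<phi>\<in>set \<phi>s. rational_function (matroid_variety M) \<phi>) \<and>
           is_product \<phi>s (matroid_variety M) (matroid_variety N)"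
proof -
  let ?r = "matroid_rank M" and ?q = "matroid_rank N"
  have ranks: "loopfree_rank ?r" "loopfree_rank ?q" using loopfree_rank_matroid assms(1-4) by blast+
  have "rank_flats ?q \<subseteq> rank_flats ?r"
    using flats_subset_if_support_subset[OF ranks] assms(5)
    by (simp add: subcycle_def matroid_variety_eq_flag_variety)
  then interpret rank_quotient ?r ?q
    using ranks by (intro rank_quotient.intro rank_quotient_axioms.intro)
  show ?thesis
    using quotient_variety_is_product[of k] assms(6) by (simp add: matroid_variety_eq_flag_variety)
qed

end
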